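(* Assume that $f\in L^\infty(\Omega)$ and $u\in H^2(\Omega)$. Then there is a constant $C>0$, which may depend on $a,b,c,f,u$ but not on $N$ or on the meshes, such that for any $N$ and any meshes $X,\tilde X\in S_N$ satisfying $$\|X-\tilde X\|_\infty<\frac1{\rho_0N},$$ the corresponding linear finite element solutions $u_h$ (on $X$) and $u_{\tilde h}$ (on $\tilde X$) satisfy $$\|(u_h-u_{\tilde h})'\|_{L^1(\Omega)}\le CN\|X-\tilde X\|_\infty,$$ $$\|u_h-u_{\tilde h}\|_\Omega\le CN^{-1/2}\|X-\tilde X\|_\infty^{1/2},$$ $$\Big|\,\|u_h\|_E^2-\|u_{\tilde h}\|_E^2\Big|\le CN^{-1/2}\|X-\tilde X\|_\infty^{1/2}.$$
   Context: Let $\Omega=(0,1)$. The functions $a,b\in W^{1,\infty}(\Omega)$, $c\in L^\infty(\Omega)$, $f\in L^2(\Omega)$ satisfy $a(x)\ge a_0>0$ and $c(x)-\frac12 b'(x)\ge 0$ a.e. in $\Omega$ for some constant $a_0$; $f$ is not a.e. zero. Put $B(w,v)=\int_\Omega(aw'v'+bw'v+cwv)\,dx$ and $(f,v)=\int_\Omega fv\,dx$. $u\in V=H_0^1(\Omega)$ is the solution of $B(u,v)=(f,v)$ for all $v\in V$ (weak form of $-(au')'+bu'+cu=f$, $u(0)=u(1)=0$). The energy norm is $\|v\|_E^2=\int_\Omega\big(a\,v'^2+(c-\frac12b')v^2\big)dx$. A mesh with $N$ elements is $0=x_0<x_1<\dots<x_N=1$, with $h_i=x_i-x_{i-1}$ and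 $K_i=(x_{i-1},x_i)$; it is identified with $X=(x_1,\dots,x_{N-1})^\top$, and $\|X\|_\infty=\max_i|x_i|$. $V_h$ is the space of continuous functions on $[0,1]$ that are linear on each $K_i$ and vanish at $0$ and $1$; $u_h\in V_h$ is the finite element solution: $B(u_h,v_h)=(f,v_h)$ for all $v_h\in V_h$. $r=f+a'u'-bu'-cu$. Define $$\rho_0=\Big[1+\gamma\Big(\frac{\|r\|_{L^\infty(\Omega)}}{\|r\|_{L^{2/3}(\Omega)}}\Big)^{2/3}\Big]^2,\qquad S_N=\Big\{X\in\mathbb R^{N-1}:\ 0=x_0<x_1<\dots<x_N=1,\ \frac1{\rho_0N}\le h_i\le\frac2N,\ i=1,\dots,N\Big\}.$$ Here $\gamma=2(1+C_1+C_2)^{2/3}$, where $C_1,C_2>0$ are fixed constants depending only on $a,b,c$ such that, for every $N\ge1$, every $s\ge1$, every right-hand side $f\in L^2(\Omega)$ (with corresponding $u$, $r$) and every mesh with $\frac1{sN}\le h_i\le\frac2N$ for all $i$: $\|b-a'\|_{L^\infty(\Omega)}\|(u-u_h)'\|_{L^\infty(\Omega)}\le C_1\sqrt{s+1}\,\|r\|_\Omega/\sqrt N$ and $\|c\|_{L^\infty(\Omega)}\|u-u_h\|_{L^\infty(\Omega)}\le C_2\|r\|_\Omega/N$. $\|\cdot\|_\Omega$ is the $L^2(\Omega)$ norm; $\|v\|_{L^p(\Omega)}=(\int_\Omega|v|^pdx)^{1/p}$ also for $0<p<1$. *)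

theory Defs
  imports "HOL-Analysis.Analysis" "HOL-Probability.Essential_Supremum"
begin

text \<open>
  Elements of Lebesgue and Sobolev spaces on the open unit interval are represented by functions
  of type \<^typ>\<open>real \<Rightarrow> real\<close>. All notions except the finite element space are invariant under
  changing a function on a null set, and none of them looks at values outside \<open>[0, 1]\<close>.
\<close>

abbreviation Om :: "real set" where
  "Om \<equiv> {0<..<1}"

abbreviation leb_Om :: "real measure" where
  "leb_Om \<equiv> lebesgue_on Om"


section \<open>Lebesgue spaces\<close>

definition Lp_space :: "real \<Rightarrow> (real \<Rightarrow> real) set" where
  "Lp_space p = {v \<in> borel_measurable leb_Om. integrable leb_Om (\<lambda>x. \<bar>v x\<bar> powr p)}"

definition Lp_norm :: "real \<Rightarrow> (real \<Rightarrow> real) \<Rightarrow> real" where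
  "Lp_norm p v = (LINT x|leb_Om. \<bar>v x\<bar> powr p) powr (1 / p)"

definition Linf_space :: "(real \<Rightarrow> real) set" where
  "Linf_space = {v \<in> borel_measurable leb_Om. esssup leb_Om (\<lambda>x. ereal \<bar>v x\<bar>) < \<infinity>}"

text \<open>The real number below is meaningful only on \<^const>\<open>Linf_space\<close>, as infinity is sent to 0.\<close>

definition Linf_norm :: "(real \<Rightarrow> real) \<Rightarrow> real" where
  "Linf_norm v = real_of_ereal (esssup leb_Om (\<lambda>x. ereal \<bar>v x\<bar>))"

definition L2_inner :: "(real \<Rightarrow> real) \<Rightarrow> (real \<Rightarrow> real) \<Rightarrow> real" where
  "L2_inner f v = (LINT x|leb_Om. f x * v x)"


section \<open>Weak derivatives and Sobolev spaces\<close>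

definition loc_integrable :: "(real \<Rightarrow> real) \<Rightarrow> bool" where
  "loc_integrable v \<longleftrightarrow> (\<forall>K. compact K \<and> K \<subseteq> Om \<longrightarrow> set_integrable lebesgue K v)"

text \<open>
  Test functions are the continuously differentiable functions with compact support in the open
  interval, as in Brezis' treatment of Sobolev spaces in one dimension; smooth test functions give
  the same weak derivatives by density. The closure is taken in the real line, so a support contained in \<open>Om\<close> is
  automatically compact.
\<close>

definition test_function :: "(real \<Rightarrow> real) \<Rightarrow> bool" where
  "test_function \<phi> \<longleftrightarrow> \<phi> C1_differentiable_on UNIV \<and> closure {x. \<phi> x \<noteq> 0} \<subseteq> Om"

definition has_weak_deriv :: "(real \<Rightarrow> real) \<Rightarrow> (real \<Rightarrow> real) \<Rightarrow> bool" where
  "has_weak_deriv v g \<longleftrightarrow>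
     loc_integrable v \<and> loc_integrable g \<and>
     (\<forall>\<phi>. test_function \<phi> \<longrightarrow>
        (LINT x|leb_Om. v x * deriv \<phi> x) = - (LINT x|leb_Om. g x * \<phi> x))"

text \<open>
  A weak derivative is unique up to null sets, so the choice made by \<open>SOME\<close> is immaterial for
  all integrals, norms and almost-everywhere statements in which \<open>wderiv\<close> occurs.
\<close>

definition wderiv :: "(real \<Rightarrow> real) \<Rightarrow> real \<Rightarrow> real" where
  "wderiv v = (SOME g. has_weak_deriv v g)"

definition W1inf_space :: "(real \<Rightarrow> real) set" where
  "W1inf_space = {v \<in> Linf_space. \<exists>g \<in> Linf_space. has_weak_deriv v g}"

definition H1_space :: "(real \<Rightarrow> real) set" where
  "H1_space = {v \<in> Lp_space 2. \<exists>g \<in> Lp_space 2. has_weak_deriv v g}"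

definition H2_space :: "(real \<Rightarrow> real) set" where
  "H2_space = {v \<in> Lp_space 2. \<exists>g \<in> H1_space. has_weak_deriv v g}"

text \<open>
  The boundary values of a function in \<^const>\<open>H1_space\<close> are those of its representative that is
  continuous on the closed interval.
\<close>

definition H10_space :: "(real \<Rightarrow> real) set" where
  "H10_space = {v \<in> H1_space.
     \<exists>w. continuous_on {0..1} w \<and> w 0 = 0 \<and> w 1 = 0 \<and> (AE x in leb_Om. v x = w x)}"


section \<open>The boundary value problem\<close>

definition bilin :: "(real \<Rightarrow> real) \<Rightarrow> (real \<Rightarrow> real) \<Rightarrow> (real \<Rightarrow> real) \<Rightarrow>
    (real \<Rightarrow> real) \<Rightarrow> (real \<Rightarrow> real) \<Rightarrow> real" where
  "bilin a b c w v =
     (LINT x|leb_Om. a x * wderiv w x * wderiv v x + b x * wderiv w x * v x + c x * w x * v x)"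

definition energy_norm :: "(real \<Rightarrow> real) \<Rightarrow> (real \<Rightarrow> real) \<Rightarrow> (real \<Rightarrow> real) \<Rightarrow>
    (real \<Rightarrow> real) \<Rightarrow> real" where
  "energy_norm a b c v =
     sqrt (LINT x|leb_Om. a x * (wderiv v x)\<^sup>2 + (c x - wderiv b x / 2) * (v x)\<^sup>2)"

definition weak_solution :: "(real \<Rightarrow> real) \<Rightarrow> (real \<Rightarrow> real) \<Rightarrow> (real \<Rightarrow> real) \<Rightarrow>
    (real \<Rightarrow> real) \<Rightarrow> (real \<Rightarrow> real) \<Rightarrow> bool" where
  "weak_solution a b c f u \<longleftrightarrow>
     u \<in> H10_space \<and> (\<forall>v \<in> H10_space. bilin a b c u v = L2_inner f v)"

definition resid :: "(real \<Rightarrow> real) \<Rightarrow> (real \<Rightarrow> real) \<Rightarrow> (real \<Rightarrow> real) \<Rightarrow>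
    (real \<Rightarrow> real) \<Rightarrow> (real \<Rightarrow> real) \<Rightarrow> real \<Rightarrow> real" where
  "resid a b c f u = (\<lambda>x. f x + wderiv a x * wderiv u x - b x * wderiv u x - c x * u x)"


section \<open>Meshes and finite element solutions\<close>

text \<open>
  A mesh with \<open>N\<close> elements is given by its nodes \<open>X 0, \<dots>, X N\<close>; values of \<open>X\<close> at larger
  indices are irrelevant.
\<close>

definition mesh :: "nat \<Rightarrow> (nat \<Rightarrow> real) \<Rightarrow> bool" where
  "mesh N X \<longleftrightarrow> X 0 = 0 \<and> X N = 1 \<and> (\<forall>i \<in> {1..N}. X (i - 1) < X i)"

definition mesh_class :: "real \<Rightarrow> nat \<Rightarrow> (nat \<Rightarrow> real) set" where
  "mesh_class s N = {X. mesh N X \<and>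
     (\<forall>i \<in> {1..N}. 1 / (s * real N) \<le> X i - X (i - 1) \<and> X i - X (i - 1) \<le> 2 / real N)}"

text \<open>
  Maximum norm of the difference of the vectors of interior nodes; for \<open>N = 1\<close> there are no
  interior nodes and the value is 0.
\<close>

definition mesh_dist :: "nat \<Rightarrow> (nat \<Rightarrow> real) \<Rightarrow> (nat \<Rightarrow> real) \<Rightarrow> real" where
  "mesh_dist N X Y = Max (insert 0 ((\<lambda>i. \<bar>X i - Y i\<bar>) ` {1..N - 1}))"

definition fe_space :: "nat \<Rightarrow> (nat \<Rightarrow> real) \<Rightarrow> (real \<Rightarrow> real) set" where
  "fe_space N X = {v. continuous_on {0..1} v \<and> v 0 = 0 \<and> v 1 = 0 \<and>
     (\<forall>i \<in> {1..N}. \<exists>p q. \<forall>x \<in> {X (i - 1)<..<X i}. v x = p + q * x)}"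

definition fe_solution :: "(real \<Rightarrow> real) \<Rightarrow> (real \<Rightarrow> real) \<Rightarrow> (real \<Rightarrow> real) \<Rightarrow>
    (real \<Rightarrow> real) \<Rightarrow> nat \<Rightarrow> (nat \<Rightarrow> real) \<Rightarrow> (real \<Rightarrow> real) \<Rightarrow> bool" where
  "fe_solution a b c f N X uh \<longleftrightarrow>
     uh \<in> fe_space N X \<and> (\<forall>v \<in> fe_space N X. bilin a b c uh v = L2_inner f v)"

text \<open>
  \<open>C1\<close> and \<open>C2\<close> are admissible constants in the maximum norm error estimates for the problem with
  coefficients \<open>a, b, c\<close>, uniformly in the right-hand side, the mesh, \<open>N\<close> and \<open>s\<close>.
\<close>

definition error_constants :: "(real \<Rightarrow> real) \<Rightarrow> (real \<Rightarrow> real) \<Rightarrow> (real \<Rightarrow> real) \<Rightarrow>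
    real \<Rightarrow> real \<Rightarrow> bool" where
  "error_constants a b c C1 C2 \<longleftrightarrow> C1 > 0 \<and> C2 > 0 \<and>
     (\<forall>N \<ge> 1. \<forall>s \<ge> 1. \<forall>f \<in> Lp_space 2. \<forall>u. weak_solution a b c f u \<longrightarrow>
       (\<forall>X \<in> mesh_class s N. \<forall>uh. fe_solution a b c f N X uh \<longrightarrow>
          Linf_norm (\<lambda>x. b x - wderiv a x) * Linf_norm (wderiv (\<lambda>x. u x - uh x))
            \<le> C1 * sqrt (s + 1) * Lp_norm 2 (resid a b c f u) / sqrt (real N) \<and>
          Linf_norm c * Linf_norm (\<lambda>x. u x - uh x)
            \<le> C2 * Lp_norm 2 (resid a b c f u) / real N))"

definition gamma_const :: "real \<Rightarrow> real \<Rightarrow> real" where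
  "gamma_const C1 C2 = 2 * (1 + C1 + C2) powr (2 / 3)"

definition rho0 :: "real \<Rightarrow> real \<Rightarrow> (real \<Rightarrow> real) \<Rightarrow> real" where
  "rho0 C1 C2 r = (1 + gamma_const C1 C2 * (Linf_norm r / Lp_norm (2 / 3) r) powr (2 / 3))\<^sup>2"

end

theory Submission
  imports Defs
begin

text \<open>
  In the maximum norm, the finite element solution is a Lipschitz continuous function of the mesh:
  \<open>\<bar>u\<^sub>X - u\<^sub>Y\<bar> \<le> P \<delta>\<close> with \<open>\<delta>\<close> the mesh distance and \<open>P\<close> independent of
  \<open>N\<close> (\<open>galerkin_perturbation\<close>). All three estimates follow from this one. The difference
  is linear on at most \<open>2 N + 3\<close> intervals, on each of which its variation is at most twice its
  maximum; this gives the first estimate, with the factor \<open>N\<close>. Since \<open>\<delta> < 1 / N\<close>, a bound by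
  \<open>\<delta>\<close> is stronger than one by the square root of \<open>\<delta> / N\<close>, which gives the second. Finally
  the squared energy norm of \<open>u\<^sub>X\<close> is the integral of \<open>f u\<^sub>X\<close>, which gives the third.

  The maximum norm estimate has three ingredients. Write \<open>B\<close> for the bilinear form and let
  \<open>v\<close> be a finite element function on \<open>X\<close>.

  \<^item> Finite element solutions have uniformly bounded derivatives (\<open>galerkin_grad_bound\<close>).
    Indeed, the flux \<open>a u\<^sub>Y'\<close> plus a primitive of \<open>f - b u\<^sub>Y' - c u\<^sub>Y\<close> has the same
    mean on all cells of \<open>Y\<close>, by Galerkin orthogonality, and coercivity controls that mean and
    the lower order terms.

  \<^item> The residual of \<open>u\<^sub>Y\<close>, tested with \<open>v\<close>, is the integral of this flux, with its mean
    subtracted, against \<open>v'\<close>. A primitive of the mean-free flux vanishes at the nodes of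
    \<open>Y\<close>, and the mean-free flux itself is of order \<open>1 / N\<close> because it is Lipschitz on each
    cell. So the primitive is of order \<open>\<delta> / N\<close> at the nodes of \<open>X\<close>, and the residual is
    bounded by \<open>\<delta>\<close> times the \<open>L\<^sup>1\<close> norm of \<open>v'\<close> (\<open>consistency_error\<close>).

  \<^item> The interpolation error \<open>\<theta>\<close> of \<open>u\<^sub>Y\<close> on the mesh \<open>X\<close> has maximum norm of order
    \<open>\<delta>\<close> (\<open>interpolation_error_nearby_mesh\<close>), and it vanishes at the nodes, so that
    \<open>B(\<theta>, v)\<close> is again bounded by \<open>\<delta>\<close> times the \<open>L\<^sup>1\<close> norm of \<open>v'\<close>
    (\<open>form_vanishing_at_nodes\<close>).

  Let \<open>w\<close> be \<open>u\<^sub>X\<close> minus the interpolant of \<open>u\<^sub>Y\<close>. Taking \<open>v = w\<close> and using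
  coercivity, \<open>w\<close> is of order \<open>\<delta>\<close>, and so is \<open>u\<^sub>X - u\<^sub>Y = w - \<theta>\<close>.

  To pass from the weak formulation to this argument, coefficients in \<open>W\<^sup>1\<^sup>,\<^sup>\<infinity>\<close> are
  replaced by Lipschitz representatives, by the lemma of du Bois-Reymond, and weak derivatives are
  shown to be unique.
\<close>

section \<open>Lipschitz functions as primitives of bounded functions\<close>

text \<open>
  Measurable on the closed unit interval and bounded there at every point (not only essentially).
  Bounded representatives of elements of \<open>L\<^sup>\<infinity>\<close> are chosen once and for all, so that
  products of such functions are integrable without further conditions.
\<close>

definition bdd_meas :: "(real \<Rightarrow> real) \<Rightarrow> bool" where
  "bdd_meas g \<longleftrightarrow> g \<in> borel_measurable (lebesgue_on {0..1}) \<and> (\<exists>M. \<forall>x\<in>{0..1}. \<bar>g x\<bar> \<le> M)"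

text \<open>
  \<open>v\<close> is, on \<open>[0, 1]\<close>, a primitive of the bounded function \<open>g\<close>. These are the
  Lipschitz functions together with an almost everywhere derivative.
\<close>

definition lip_deriv :: "(real \<Rightarrow> real) \<Rightarrow> (real \<Rightarrow> real) \<Rightarrow> bool" where
  "lip_deriv v g \<longleftrightarrow> bdd_meas g \<and> (\<forall>x\<in>{0..1}. v x = v 0 + integral {0..x} g)"

lemma bdd_measE:
  assumes "bdd_meas g"
  obtains M where "M \<ge> 0" "\<And>x. x \<in> {0..1} \<Longrightarrow> \<bar>g x\<bar> \<le> M"
proof -
  obtain M where "\<forall>x\<in>{0..1}. \<bar>g x\<bar> \<le> M"
    using assms unfolding bdd_meas_def by blast
  then show ?thesis
    by (intro that[of "max M 0"]) (auto simp: le_max_iff_disj)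
qed

lemma bdd_measI:
  assumes "g \<in> borel_measurable (lebesgue_on {0..1})" "\<And>x. x \<in> {0..1} \<Longrightarrow> \<bar>g x\<bar> \<le> M"
  shows "bdd_meas g"
  using assms unfolding bdd_meas_def by blast

named_theorems bdd_meas_intros

lemma bdd_meas_const [bdd_meas_intros]: "bdd_meas (\<lambda>x. k)"
  by (rule bdd_measI[of _ "\<bar>k\<bar>"]) auto

lemma bdd_meas_add [bdd_meas_intros]:
  assumes "bdd_meas g" "bdd_meas h"
  shows "bdd_meas (\<lambda>x. g x + h x)"
proof -
  obtain M N where "\<And>x. x \<in> {0..1} \<Longrightarrow> \<bar>g x\<bar> \<le> M" "\<And>x. x \<in> {0..1} \<Longrightarrow> \<bar>h x\<bar> \<le> N"
    using assms bdd_measE by metis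
  then show ?thesis
    using assms by (intro bdd_measI[of _ "M + N"]) (auto simp: bdd_meas_def intro: abs_triangle_ineq[THEN order_trans] add_mono)
qed

lemma bdd_meas_mult [bdd_meas_intros]:
  assumes "bdd_meas g" "bdd_meas h"
  shows "bdd_meas (\<lambda>x. g x * h x)"
proof -
  obtain M N where *: "M \<ge> 0" "\<And>x. x \<in> {0..1} \<Longrightarrow> \<bar>g x\<bar> \<le> M" "\<And>x. x \<in> {0..1} \<Longrightarrow> \<bar>h x\<bar> \<le> N"
    using assms bdd_measE by metis
  then show ?thesis
    using assms by (intro bdd_measI[of _ "M * N"]) (auto simp: bdd_meas_def abs_mult intro!: mult_mono)
qed

lemma bdd_meas_uminus [bdd_meas_intros]: "bdd_meas g \<Longrightarrow> bdd_meas (\<lambda>x. - g x)"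
  using bdd_meas_mult[OF bdd_meas_const[of "-1"], of g] by simp

lemma bdd_meas_diff [bdd_meas_intros]:
  "bdd_meas g \<Longrightarrow> bdd_meas h \<Longrightarrow> bdd_meas (\<lambda>x. g x - h x)"
  using bdd_meas_add[of g "\<lambda>x. - h x"] bdd_meas_uminus[of h] by simp

lemma bdd_meas_divide [bdd_meas_intros]: "bdd_meas g \<Longrightarrow> bdd_meas (\<lambda>x. g x / k)"
  using bdd_meas_mult[OF bdd_meas_const[of "1 / k"], of g] by simp

lemma bdd_meas_power [bdd_meas_intros]: "bdd_meas g \<Longrightarrow> bdd_meas (\<lambda>x. (g x)\<^sup>2)"
  unfolding power2_eq_square by (intro bdd_meas_mult)

lemma bdd_meas_abs [bdd_meas_intros]:
  assumes "bdd_meas g"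
  shows "bdd_meas (\<lambda>x. \<bar>g x\<bar>)"
proof -
  obtain M where "\<And>x. x \<in> {0..1} \<Longrightarrow> \<bar>g x\<bar> \<le> M"
    using assms bdd_measE by metis
  then show ?thesis
    using assms by (intro bdd_measI[of _ M]) (auto simp: bdd_meas_def)
qed

lemma bdd_meas_max [bdd_meas_intros]:
  assumes "bdd_meas g" "bdd_meas h"
  shows "bdd_meas (\<lambda>x. max (g x) (h x))"
proof -
  have "(\<lambda>x. max (g x) (h x)) = (\<lambda>x. (g x + h x + \<bar>g x - h x\<bar>) / 2)"
    by (auto simp: max_def fun_eq_iff)
  then show ?thesis
    using assms by (simp only:) (intro bdd_meas_intros)
qed

lemma bdd_meas_sum [bdd_meas_intros]:
  "(\<And>i. i \<in> I \<Longrightarrow> bdd_meas (g i)) \<Longrightarrow> bdd_meas (\<lambda>x. \<Sum>i\<in>I. g i x)"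
  by (induction I rule: infinite_finite_induct) (auto intro!: bdd_meas_intros)

lemma bdd_meas_indicator [bdd_meas_intros]: "S \<in> sets borel \<Longrightarrow> bdd_meas (indicator S)"
  by (rule bdd_measI[of _ 1]) (auto intro!: borel_measurable_indicator' measurable_restrict_space1 simp: indicator_def)

lemma bdd_meas_continuous:
  assumes "continuous_on {0..1} v"
  shows "bdd_meas v"
proof -
  have "compact (v ` {0..1})"
    using assms by (intro compact_continuous_image) auto
  then obtain M where "\<forall>x\<in>{0..1}. \<bar>v x\<bar> \<le> M"
    using compact_imp_bounded[of "v ` {0..1}"] by (auto simp: bounded_iff)
  then show ?thesis
    using continuous_imp_measurable_on_sets_lebesgue[OF assms] by (intro bdd_measI) auto
qed

lemma bdd_meas_integrable:
  assumes "bdd_meas g" "0 \<le> s" "t \<le> 1"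
  shows "g integrable_on {s..t}"
proof -
  obtain M where M: "\<And>x. x \<in> {0..1} \<Longrightarrow> \<bar>g x\<bar> \<le> M"
    using assms bdd_measE by metis
  have "g integrable_on {0..1}"
    by (rule measurable_bounded_by_integrable_imp_integrable_real[where g = "\<lambda>_. M"])
       (use assms M in \<open>auto simp: bdd_meas_def\<close>)
  then show ?thesis
    using assms by (auto intro: integrable_on_subinterval)
qed

lemma bdd_meas_abs_integral_le:
  assumes "bdd_meas g" "0 \<le> s" "s \<le> t" "t \<le> 1" "finite S"
    and "\<And>x. s \<le> x \<Longrightarrow> x \<le> t \<Longrightarrow> x \<notin> S \<Longrightarrow> \<bar>g x\<bar> \<le> B" "B \<ge> 0"
  shows "\<bar>integral {s..t} g\<bar> \<le> B * (t - s)"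
proof -
  have "(g has_integral integral {s..t} g) (cbox s t)"
    using bdd_meas_integrable[OF assms(1,2,4)] by auto
  from has_integral_bound_spike_finite[OF assms(7,5) this] show ?thesis
    using assms by auto
qed

lemma integral_abs_ge:
  assumes "bdd_meas g" "0 \<le> s" "t \<le> 1"
  shows "\<bar>integral {s..t} g\<bar> \<le> integral {s..t} (\<lambda>x. \<bar>g x\<bar>)"
  using integral_norm_bound_integral[OF bdd_meas_integrable[OF assms]
      bdd_meas_integrable[OF bdd_meas_abs[OF assms(1)] assms(2,3)]]
  by auto

lemma integral_mono_subset:
  assumes "bdd_meas g" "\<And>x. x \<in> {0..1} \<Longrightarrow> g x \<ge> 0" "0 \<le> s" "t \<le> 1"
  shows "integral {s..t} g \<le> integral {0..1} g"
  by (rule integral_subset_le) (use assms bdd_meas_integrable[of g] in auto)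

lemma integral_abs_mult_le:
  assumes "bdd_meas g" "bdd_meas h" "\<And>x. x \<in> {0..1} \<Longrightarrow> \<bar>g x\<bar> \<le> M" "0 \<le> s" "t \<le> 1"
  shows "\<bar>integral {s..t} (\<lambda>x. g x * h x)\<bar> \<le> M * integral {s..t} (\<lambda>x. \<bar>h x\<bar>)"
proof -
  have "\<bar>integral {s..t} (\<lambda>x. g x * h x)\<bar> \<le> integral {s..t} (\<lambda>x. M * \<bar>h x\<bar>)"
    unfolding real_norm_def[symmetric]
    by (rule integral_norm_bound_integral)
       (use assms in \<open>auto intro!: bdd_meas_integrable bdd_meas_intros mult_right_mono simp: abs_mult\<close>)
  then show ?thesis by simp
qed

lemma integral_abs_square_le:
  assumes "bdd_meas g"
  shows "(integral {0..1} (\<lambda>x. \<bar>g x\<bar>))\<^sup>2 \<le> integral {0..1} (\<lambda>x. (g x)\<^sup>2)"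
proof -
  define m where "m = integral {0..1} (\<lambda>x. \<bar>g x\<bar>)"
  have i1: "(\<lambda>x. \<bar>g x\<bar>) integrable_on {0..1}" and i2: "(\<lambda>x. (g x)\<^sup>2) integrable_on {0..1}"
    using assms by (auto intro!: bdd_meas_integrable bdd_meas_intros)
  have "0 \<le> integral {0..1} (\<lambda>x. (\<bar>g x\<bar> - m)\<^sup>2)"
    using assms by (intro integral_nonneg) (auto intro!: bdd_meas_integrable bdd_meas_intros)
  also have "\<dots> = integral {0..1} (\<lambda>x. (g x)\<^sup>2 - (2 * m) * \<bar>g x\<bar> + m\<^sup>2)"
    by (intro integral_cong) (auto simp: power2_eq_square algebra_simps)
  also have "\<dots> = integral {0..1} (\<lambda>x. (g x)\<^sup>2) - (2 * m) * m + m\<^sup>2"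
    using i1 i2 by (subst integral_add)
      (auto simp: m_def integral_diff integrable_on_mult_right intro!: integrable_diff)
  finally show ?thesis
    unfolding m_def by (simp add: power2_eq_square)
qed

lemma lip_deriv_bdd_meas: "lip_deriv v g \<Longrightarrow> bdd_meas g"
  by (simp add: lip_deriv_def)

lemma lip_deriv_eq:
  "lip_deriv v g \<Longrightarrow> x \<in> {0..1} \<Longrightarrow> v x = v 0 + integral {0..x} g"
  unfolding lip_deriv_def by blast

lemma lip_deriv_increment:
  assumes "lip_deriv v g" "0 \<le> s" "s \<le> t" "t \<le> 1"
  shows "v t - v s = integral {s..t} g"
proof -
  have "integral {0..s} g + integral {s..t} g = integral {0..t} g"
    using assms by (intro Henstock_Kurzweil_Integration.integral_combine bdd_meas_integrable)
      (auto dest: lip_deriv_bdd_meas)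
  moreover have "v t = v 0 + integral {0..t} g" "v s = v 0 + integral {0..s} g"
    using assms by (intro lip_deriv_eq; simp)+
  ultimately show ?thesis by simp
qed

lemma lip_deriv_continuous:
  assumes "lip_deriv v g"
  shows "continuous_on {0..1} v"
proof -
  have "continuous_on {0..1} (\<lambda>x. v 0 + integral {0..x} g)"
    using assms by (intro continuous_intros indefinite_integral_continuous_1 bdd_meas_integrable)
      (auto dest: lip_deriv_bdd_meas)
  then show ?thesis
    using lip_deriv_eq[OF assms] by (metis (no_types, lifting) continuous_on_cong)
qed

lemma lip_deriv_bdd_meas_fun: "lip_deriv v g \<Longrightarrow> bdd_meas v"
  by (rule bdd_meas_continuous[OF lip_deriv_continuous])

lemma lip_deriv_bound:
  assumes "lip_deriv v g" "s \<in> {0..1}" "t \<in> {0..1}"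
    and "\<And>x. x \<in> {0..1} \<Longrightarrow> \<bar>g x\<bar> \<le> M"
  shows "\<bar>v t - v s\<bar> \<le> M * \<bar>t - s\<bar>"
proof -
  have *: "\<bar>v t - v s\<bar> \<le> M * (t - s)" if "0 \<le> s" "s \<le> t" "t \<le> 1" for s t
  proof -
    have "M \<ge> 0" using assms(4)[of 0] by auto
    then show ?thesis
      unfolding lip_deriv_increment[OF assms(1) that]
      by (intro bdd_meas_abs_integral_le[where S = "{}"]) (use assms that in \<open>auto dest: lip_deriv_bdd_meas\<close>)
  qed
  show ?thesis
    using *[of s t] *[of t s] assms(2,3) by (cases "s \<le> t") auto
qed

lemma lip_deriv_abs_le:
  assumes "lip_deriv v g" "v 0 = 0" "x \<in> {0..1}"
  shows "\<bar>v x\<bar> \<le> integral {0..1} (\<lambda>x. \<bar>g x\<bar>)"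
proof -
  have bm: "bdd_meas g" using assms by (auto dest: lip_deriv_bdd_meas)
  have "\<bar>v x\<bar> = \<bar>integral {0..x} g\<bar>"
    using lip_deriv_eq[OF assms(1,3)] assms(2) by simp
  also have "\<dots> \<le> integral {0..x} (\<lambda>x. \<bar>g x\<bar>)"
    using assms by (intro integral_abs_ge bm) auto
  also have "\<dots> \<le> integral {0..1} (\<lambda>x. \<bar>g x\<bar>)"
    using assms by (intro integral_mono_subset bdd_meas_abs bm) auto
  finally show ?thesis .
qed

lemma lip_deriv_primitive:
  assumes "bdd_meas g"
  shows "lip_deriv (\<lambda>x. k + integral {0..x} g) g"
  using assms by (auto simp: lip_deriv_def)

lemma lip_deriv_diff:
  assumes "lip_deriv v g" "lip_deriv w h"
  shows "lip_deriv (\<lambda>x. v x - w x) (\<lambda>x. g x - h x)"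
  unfolding lip_deriv_def
proof (intro conjI ballI)
  show "bdd_meas (\<lambda>x. g x - h x)"
    using assms by (auto intro!: bdd_meas_intros dest: lip_deriv_bdd_meas)
  fix x :: real assume x: "x \<in> {0..1}"
  have "integral {0..x} (\<lambda>x. g x - h x) = integral {0..x} g - integral {0..x} h"
    using assms x by (intro integral_diff bdd_meas_integrable) (auto dest: lip_deriv_bdd_meas)
  moreover have "v x = v 0 + integral {0..x} g" "w x = w 0 + integral {0..x} h"
    using assms x by (auto intro: lip_deriv_eq)
  ultimately show "v x - w x = v 0 - w 0 + integral {0..x} (\<lambda>x. g x - h x)"
    by simp
qed

lemma const_if_quadratic_increments:
  fixes P :: "real \<Rightarrow> real"
  assumes "\<And>s t. 0 \<le> s \<Longrightarrow> s \<le> t \<Longrightarrow> t \<le> 1 \<Longrightarrow> \<bar>P t - P s\<bar> \<le> C * (t - s)\<^sup>2"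
    and "x \<in> {0..1}"
  shows "P x = P 0"
proof -
  have C: "\<bar>P t - P s\<bar> \<le> C * (t - s)\<^sup>2" if "s \<in> {0..1}" "t \<in> {0..1}" for s t
    using assms(1)[of s t] assms(1)[of t s] that
    by (cases "s \<le> t") (auto simp: abs_minus_commute power2_commute)
  have der: "(P has_field_derivative 0) (at s within {0..1})" if s: "s \<in> {0..1}" for s
  proof -
    have "((\<lambda>t. (P t - P s) / (t - s)) \<longlongrightarrow> 0) (at s within {0..1})"
    proof (rule Lim_null_comparison)
      show "\<forall>\<^sub>F t in at s within {0..1}. norm ((P t - P s) / (t - s)) \<le> C * \<bar>t - s\<bar>"
        unfolding eventually_at_filter
      proof (intro always_eventually allI impI)
        fix t assume t: "t \<noteq> s" "t \<in> {0..1}"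
        have "\<bar>P t - P s\<bar> / \<bar>t - s\<bar> \<le> C * (t - s)\<^sup>2 / \<bar>t - s\<bar>"
          using C[OF s t(2)] by (intro divide_right_mono) auto
        also have "\<dots> = C * \<bar>t - s\<bar>"
          using t by (cases "s < t") (auto simp: power2_eq_square field_simps abs_if)
        finally show "norm ((P t - P s) / (t - s)) \<le> C * \<bar>t - s\<bar>" by simp
      qed
      have "((\<lambda>t. C * \<bar>t - s\<bar>) \<longlongrightarrow> C * \<bar>s - s\<bar>) (at s within {0..1})"
        by (intro tendsto_intros)
      then show "((\<lambda>t. C * \<bar>t - s\<bar>) \<longlongrightarrow> 0) (at s within {0..1})" by simp
    qed
    then show ?thesis
      by (simp add: has_field_derivative_iff)
  qed
  have "\<exists>c. \<forall>x\<in>{0..1}. P x = c"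
    by (intro has_field_derivative_zero_constant) (use der in auto)
  then show ?thesis using assms(2) by auto
qed

text \<open>
  The product rule. The difference of the two sides has increments of quadratic order, because the
  factors vary by at most a multiple of \<open>t - s\<close> on \<open>[s, t]\<close>; hence it is constant.
\<close>

lemma lip_deriv_mult:
  assumes v: "lip_deriv v g" and w: "lip_deriv w h"
  shows "lip_deriv (\<lambda>x. v x * w x) (\<lambda>x. g x * w x + v x * h x)"
proof -
  have bm: "bdd_meas v" "bdd_meas w" "bdd_meas g" "bdd_meas h"
    using assms lip_deriv_bdd_meas_fun lip_deriv_bdd_meas by auto
  let ?d = "\<lambda>x. g x * w x + v x * h x"
  have bmd: "bdd_meas ?d" by (intro bdd_meas_intros bm)
  define P where "P t = v t * w t - integral {0..t} ?d" for t
  obtain G where G: "G \<ge> 0" "\<And>x. x \<in> {0..1} \<Longrightarrow> \<bar>g x\<bar> \<le> G" using bm bdd_measE by metis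
  obtain H where H: "H \<ge> 0" "\<And>x. x \<in> {0..1} \<Longrightarrow> \<bar>h x\<bar> \<le> H" using bm bdd_measE by metis
  have P: "\<bar>P t - P s\<bar> \<le> (2 * G * H) * (t - s)\<^sup>2" if st: "0 \<le> s" "s \<le> t" "t \<le> 1" for s t
  proof -
    let ?r = "\<lambda>x. g x * (w t - w x) + (v s - v x) * h x"
    have i: "f integrable_on {s..t}" if "bdd_meas f" for f
      using that st by (intro bdd_meas_integrable) auto
    have "integral {0..t} ?d - integral {0..s} ?d = integral {s..t} ?d"
      using Henstock_Kurzweil_Integration.integral_combine[of 0 s t ?d] bdd_meas_integrable[OF bmd, of 0 t] st by simp
    moreover have "v t * w t - v s * w s = integral {s..t} g * w t + v s * integral {s..t} h"
      using lip_deriv_increment[OF v st] lip_deriv_increment[OF w st] by (simp flip: add: algebra_simps)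
    moreover have "integral {s..t} g * w t + v s * integral {s..t} h = integral {s..t} (\<lambda>x. g x * w t + v s * h x)"
      by (subst integral_add) (auto intro!: i bdd_meas_intros bm)
    moreover have "integral {s..t} (\<lambda>x. g x * w t + v s * h x) - integral {s..t} ?d
        = integral {s..t} (\<lambda>x. (g x * w t + v s * h x) - ?d x)"
      by (subst integral_diff) (auto intro!: i bdd_meas_intros bm)
    moreover have "(\<lambda>x. (g x * w t + v s * h x) - ?d x) = ?r"
      by (auto simp: algebra_simps)
    ultimately have "P t - P s = integral {s..t} ?r"
      by (simp add: P_def)
    also have "\<bar>\<dots>\<bar> \<le> (2 * G * H * (t - s)) * (t - s)"
    proof (rule bdd_meas_abs_integral_le[where S = "{}"])
      fix x assume x: "s \<le> x" "x \<le> t"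
      have "\<bar>g x * (w t - w x)\<bar> \<le> G * (H * \<bar>t - x\<bar>)"
        unfolding abs_mult using x st G by (intro mult_mono lip_deriv_bound[OF w] H) auto
      moreover have "\<bar>(v s - v x) * h x\<bar> \<le> (G * \<bar>s - x\<bar>) * H"
        unfolding abs_mult using x st G H by (intro mult_mono lip_deriv_bound[OF v] H) auto
      moreover have "G * H * \<bar>t - x\<bar> \<le> G * H * (t - s)" "G * H * \<bar>s - x\<bar> \<le> G * H * (t - s)"
        using G H x by (auto intro!: mult_left_mono)
      ultimately show "\<bar>?r x\<bar> \<le> 2 * G * H * (t - s)"
        by (simp add: algebra_simps)
    qed (use st G H bm in \<open>auto intro!: bdd_meas_intros\<close>)
    finally show ?thesis by (simp add: power2_eq_square algebra_simps)
  qed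
  have "P x = P 0" if "x \<in> {0..1}" for x
    using const_if_quadratic_increments[of P, OF P that] by simp
  then have "v x * w x = v 0 * w 0 + integral {0..x} ?d" if "x \<in> {0..1}" for x
    using that by (fastforce simp: P_def)
  then show ?thesis
    using bmd unfolding lip_deriv_def by blast
qed

lemma integral_by_parts_lip:
  assumes v: "lip_deriv v g" and w: "lip_deriv w h" and st: "0 \<le> s" "s \<le> t" "t \<le> 1"
  shows "integral {s..t} (\<lambda>x. v x * h x) = v t * w t - v s * w s - integral {s..t} (\<lambda>x. g x * w x)"
proof -
  have bm: "bdd_meas v" "bdd_meas w" "bdd_meas g" "bdd_meas h"
    using assms lip_deriv_bdd_meas_fun lip_deriv_bdd_meas by auto
  have "v t * w t - v s * w s = integral {s..t} (\<lambda>x. g x * w x + v x * h x)"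
    using lip_deriv_increment[OF lip_deriv_mult[OF v w] st] .
  also have "\<dots> = integral {s..t} (\<lambda>x. g x * w x) + integral {s..t} (\<lambda>x. v x * h x)"
    using st by (intro integral_add bdd_meas_integrable bdd_meas_intros bm) auto
  finally show ?thesis by simp
qed

section \<open>Weak derivatives\<close>

lemma AE_leb_Om_iff_negligible:
  "(AE x in leb_Om. P x) \<longleftrightarrow> (\<exists>S. negligible S \<and> (\<forall>x\<in>Om. x \<notin> S \<longrightarrow> P x))"
proof -
  have "(AE x in leb_Om. P x) \<longleftrightarrow> (AE x in lebesgue. x \<in> Om \<longrightarrow> P x)"
    by (subst AE_restrict_space_iff) auto
  also have "\<dots> \<longleftrightarrow> (\<exists>S\<in>null_sets lebesgue. {x. \<not> (x \<in> Om \<longrightarrow> P x)} \<subseteq> S)"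
    by (subst eventually_ae_filter) auto
  also have "\<dots> \<longleftrightarrow> (\<exists>S. negligible S \<and> (\<forall>x\<in>Om. x \<notin> S \<longrightarrow> P x))"
    unfolding negligible_iff_null_sets subset_eq by blast
  finally show ?thesis .
qed

lemma bdd_meas_absolutely_integrable:
  assumes "bdd_meas F"
  shows "F absolutely_integrable_on {0..1}"
  unfolding absolutely_integrable_on_def
  using bdd_meas_integrable[OF assms, of 0 1] bdd_meas_integrable[OF bdd_meas_abs[OF assms], of 0 1] by simp

lemma LINT_Om_eq_integral:
  assumes F: "bdd_meas F" and G: "AE x in leb_Om. G x = F x"
  shows "integrable leb_Om G" "(LINT x|leb_Om. G x) = integral {0..1} F"
proof -
  obtain S where S: "negligible S" "\<And>x. x \<in> Om - S \<Longrightarrow> G x = F x"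
    using G unfolding AE_leb_Om_iff_negligible by blast
  have "F absolutely_integrable_on Om"
    using bdd_meas_absolutely_integrable[OF F] by (rule set_integrable_subset) auto
  then have "G absolutely_integrable_on Om"
    using S by (rule absolutely_integrable_spike)
  then show int: "integrable leb_Om G"
    by (simp add: integrable_restrict_space set_integrable_def)
  have "(LINT x|leb_Om. G x) = integral Om G"
    using int by (intro lebesgue_integral_eq_integral) auto
  also have "\<dots> = integral Om F"
    using S by (intro integral_spike[of S]) auto
  finally show "(LINT x|leb_Om. G x) = integral {0..1} F"
    by (simp add: integral_open_interval_real)
qed

lemma bdd_meas_loc_integrable: "bdd_meas F \<Longrightarrow> loc_integrable F"
  unfolding loc_integrable_def
  by (intro allI impI set_integrable_subset[OF bdd_meas_absolutely_integrable]) (auto dest: compact_imp_closed)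

lemma Linf_space_bounded_representative:
  assumes "v \<in> Linf_space"
  obtains w where "bdd_meas w" "AE x in leb_Om. v x = w x"
proof -
  define E where "E = esssup leb_Om (\<lambda>x. ereal \<bar>v x\<bar>)"
  have v: "v \<in> borel_measurable leb_Om" and "E < \<infinity>"
    using assms by (auto simp: Linf_space_def E_def)
  then obtain M where M: "E \<le> ereal M"
    by (cases E) (auto intro: that)
  define w where "w x = max (- M) (min M (if x \<in> Om then v x else 0))" for x
  have "(\<lambda>x. if x \<in> Om then v x else 0) \<in> borel_measurable lebesgue"
    using v by (intro borel_measurable_if_I) auto
  then have "(\<lambda>x. if x \<in> Om then v x else 0) \<in> borel_measurable (lebesgue_on {0..1})"
    by (rule measurable_restrict_space1)
  then have "w \<in> borel_measurable (lebesgue_on {0..1})"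
    unfolding w_def by measurable
  then have "bdd_meas w"
    by (rule bdd_measI[of _ "\<bar>M\<bar>"]) (auto simp: w_def)
  moreover have "AE x in leb_Om. v x = w x"
  proof -
    have "AE x in leb_Om. ereal \<bar>v x\<bar> \<le> E"
      unfolding E_def by (rule esssup_AE)
    moreover have "AE x in leb_Om. x \<in> Om"
      using AE_space[of leb_Om] by simp
    ultimately show ?thesis
    proof eventually_elim
      case (elim x)
      then have "\<bar>v x\<bar> \<le> M"
        using M by (metis ereal_less_eq(3) order_trans)
      then show ?case using elim by (auto simp: w_def)
    qed
  qed
  ultimately show ?thesis by (rule that)
qed

lemma AE_zero_if_interval_integrals_zero:
  assumes g: "g absolutely_integrable_on {p..q::real}"
    and zero: "\<And>s t. p \<le> s \<Longrightarrow> s \<le> t \<Longrightarrow> t \<le> q \<Longrightarrow> integral {s..t} g = (0::real)"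
  shows "AE x in lebesgue. x \<in> {p..q} \<longrightarrow> g x = 0"
proof -
  have gi: "g integrable_on cbox p q"
    using g absolutely_integrable_on_def by auto
  \<comment> \<open>By Henstock's lemma, the Riemann sums of \<open>\<bar>g\<bar>\<close> over fine tagged divisions tend to zero.\<close>
  have "((\<lambda>x. \<bar>g x\<bar>) has_integral 0) (cbox p q)"
    unfolding has_integral
  proof (intro allI impI)
    fix e :: real assume "e > 0"
    then obtain \<gamma> where \<gamma>: "gauge \<gamma>"
      and less: "\<And>D. \<lbrakk>D tagged_partial_division_of cbox p q; \<gamma> fine D\<rbrakk> \<Longrightarrow>
             sum (\<lambda>(x,k). norm (measure lborel k *\<^sub>R g x - integral k g)) D < e"
      by (rule Henstock_lemma[OF gi]) blast
    have "norm ((\<Sum>(x,k)\<in>D. measure lborel k *\<^sub>R \<bar>g x\<bar>) - 0) < e"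
      if D: "D tagged_division_of cbox p q" "\<gamma> fine D" for D
    proof -
      have "(\<Sum>(x,k)\<in>D. measure lborel k *\<^sub>R \<bar>g x\<bar>) = (\<Sum>(x,k)\<in>D. norm (measure lborel k *\<^sub>R g x - integral k g))"
      proof (rule sum.cong[OF refl], safe)
        fix x k assume "(x, k) \<in> D"
        then obtain s t where k: "k = cbox s t" "k \<subseteq> cbox p q" "x \<in> k"
          using tagged_division_ofD(2,3,4)[OF D(1)] by metis
        then have "integral k g = 0"
          using zero[of s t] by auto
        then show "measure lborel k *\<^sub>R \<bar>g x\<bar> = norm (measure lborel k *\<^sub>R g x - integral k g)"
          by (simp add: abs_mult)
      qed
      also have "\<dots> < e"
        using D by (intro less) (simp_all add: tagged_division_of_def)
      finally have "(\<Sum>(x,k)\<in>D. measure lborel k *\<^sub>R \<bar>g x\<bar>) < e" .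
      moreover have "(\<Sum>(x,k)\<in>D. measure lborel k *\<^sub>R \<bar>g x\<bar>) \<ge> 0"
        by (intro sum_nonneg) (auto simp: split_def)
      ultimately show ?thesis by simp
    qed
    note small = this
    show "\<exists>\<gamma>. gauge \<gamma> \<and> (\<forall>D. D tagged_division_of cbox p q \<and> \<gamma> fine D \<longrightarrow>
        norm ((\<Sum>(x,k)\<in>D. measure lborel k *\<^sub>R \<bar>g x\<bar>) - 0) < e)"
      by (rule exI[of _ \<gamma>]) (simp only: \<gamma> simp_thms, intro allI impI small; simp)
  qed
  then have 0: "integral {p..q} (\<lambda>x. \<bar>g x\<bar>) = 0"
    by (auto simp: integral_unique)
  have "(\<lambda>x. \<bar>g x\<bar>) absolutely_integrable_on {p..q}"
    using absolutely_integrable_norm[OF g] by (simp add: o_def)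
  then have "set_integrable lebesgue {p..q} (\<lambda>x. \<bar>g x\<bar>)"
    and "(LINT x:{p..q}|lebesgue. \<bar>g x\<bar>) = 0"
    using 0 set_lebesgue_integral_eq_integral(2)[of "{p..q}" "\<lambda>x. \<bar>g x\<bar>"] by auto
  then have "AE x in lebesgue. indicator {p..q} x *\<^sub>R \<bar>g x\<bar> = 0"
    unfolding set_integrable_def set_lebesgue_integral_def
    by (subst (asm) integral_nonneg_eq_0_iff_AE) (auto simp: indicator_def)
  then show ?thesis
    by eventually_elim (auto simp: indicator_def)
qed

lemma has_real_derivative_max_zero_square:
  "((\<lambda>y::real. (max 0 y)\<^sup>2) has_real_derivative 2 * max 0 y) (at y)"
proof (cases y "0::real" rule: linorder_cases)
  case less
  have "((\<lambda>y::real. 0) has_real_derivative 2 * max 0 y) (at y)"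
    using less by (auto simp: max_def intro!: derivative_eq_intros)
  then show ?thesis
    by (rule has_field_derivative_transform_within_open[where S = "{..<0}"]) (use less in auto)
next
  case greater
  have "((\<lambda>y::real. y\<^sup>2) has_real_derivative 2 * max 0 y) (at y)"
    using greater by (auto simp: max_def intro!: derivative_eq_intros)
  then show ?thesis
    by (rule has_field_derivative_transform_within_open[where S = "{0<..}"]) (use greater in \<open>auto simp: max_def\<close>)
next
  case equal
  have "((\<lambda>h::real. (max 0 h)\<^sup>2 / h) \<longlongrightarrow> 0) (at 0)"
  proof (rule Lim_null_comparison)
    show "\<forall>\<^sub>F h in at (0::real). norm ((max 0 h)\<^sup>2 / h) \<le> \<bar>h\<bar>"
      by (rule always_eventually) (auto simp: max_def power2_eq_square)
    show "((\<lambda>h::real. \<bar>h\<bar>) \<longlongrightarrow> 0) (at 0)"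
      by (intro tendsto_rabs_zero tendsto_ident_at)
  qed
  then show ?thesis
    using equal by (simp add: DERIV_def)
qed

text \<open>
  Continuously differentiable functions with support \<open>[s, t]\<close> and values in \<open>[0, 1)\<close> that increase
  to the indicator function of \<open>(s, t)\<close> as \<open>n\<close> tends to infinity.
\<close>

definition bump :: "real \<Rightarrow> real \<Rightarrow> nat \<Rightarrow> real \<Rightarrow> real" where
  "bump s t n x = 1 - 1 / (1 + real n * (max 0 ((x - s) * (t - x)))\<^sup>2)"

lemma bump_denominator: "1 + real n * y\<^sup>2 \<ge> 1" "1 + real n * y\<^sup>2 \<noteq> 0"
proof -
  have "real n * y\<^sup>2 \<ge> 0" by simp
  then show "1 + real n * y\<^sup>2 \<ge> 1" "1 + real n * y\<^sup>2 \<noteq> 0" by linarith+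
qed

lemma bump_range: "0 \<le> bump s t n x" "bump s t n x \<le> 1"
proof -
  define d where "d = 1 + real n * (max 0 ((x - s) * (t - x)))\<^sup>2"
  have "d \<ge> 1" unfolding d_def by (rule bump_denominator)
  then have "0 \<le> 1 / d" "1 / d \<le> 1" by auto
  then show "0 \<le> bump s t n x" "bump s t n x \<le> 1"
    by (simp_all add: bump_def d_def)
qed

lemma bump_outside:
  assumes "x \<notin> {s<..<t}" "s \<le> t"
  shows "bump s t n x = 0"
proof -
  have "(x - s) * (t - x) \<le> 0"
    using assms by (auto simp: mult_le_0_iff)
  then show ?thesis by (simp add: bump_def max_def)
qed

lemma bump_tendsto:
  assumes "x \<in> {s<..<t}"
  shows "(\<lambda>n. bump s t n x) \<longlonglongrightarrow> 1"
proof -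
  define z where "z = (max 0 ((x - s) * (t - x)))\<^sup>2"
  have "z > 0" using assms by (auto simp: z_def max_def mult_le_0_iff not_le)
  have "filterlim (\<lambda>n. real n * z) at_top sequentially"
    using \<open>z > 0\<close> by (intro filterlim_at_top_mult_tendsto_pos[OF tendsto_const] filterlim_real_sequentially) auto
  then have "filterlim (\<lambda>n. 1 + real n * z) at_top sequentially"
    by (intro filterlim_tendsto_add_at_top[OF tendsto_const])
  then have "(\<lambda>n. 1 / (1 + real n * z)) \<longlonglongrightarrow> 0"
    by (intro tendsto_divide_0[OF tendsto_const] filterlim_at_top_imp_at_infinity)
  then have "(\<lambda>n. 1 - 1 / (1 + real n * z)) \<longlonglongrightarrow> 1 - 0"
    by (intro tendsto_diff tendsto_const)
  then show ?thesis by (simp add: bump_def z_def)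
qed

lemma bump_C1:
  obtains D where "\<And>x. (bump s t n has_real_derivative D x) (at x)" "continuous_on UNIV D"
proof -
  define r where "r x = (max 0 ((x - s) * (t - x)))\<^sup>2" for x
  define r' where "r' x = 2 * max 0 ((x - s) * (t - x)) * (s + t - 2 * x)" for x
  have r: "(r has_real_derivative r' x) (at x)" for x
    unfolding r_def r'_def
    by (rule DERIV_chain2[OF has_real_derivative_max_zero_square])
       (auto intro!: derivative_eq_intros)
  have nz: "1 + real n * r x \<noteq> 0" for x
    unfolding r_def by (rule bump_denominator)
  have b: "bump s t n = (\<lambda>x. 1 - 1 / (1 + real n * r x))"
    by (auto simp: bump_def r_def)
  show ?thesis
  proof
    show "(bump s t n has_real_derivative real n * r' x / (1 + real n * r x)\<^sup>2) (at x)" for x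
      unfolding b using nz[of x]
      by (auto intro!: derivative_eq_intros r simp: power2_eq_square)
    have "continuous_on UNIV r" "continuous_on UNIV r'"
      unfolding r_def r'_def by (intro continuous_intros)+
    then show "continuous_on UNIV (\<lambda>x. real n * r' x / (1 + real n * r x)\<^sup>2)"
      using nz by (intro continuous_intros) auto
  qed
qed

lemma bump_continuous: "continuous_on UNIV (bump s t n)"
  by (metis DERIV_isCont bump_C1 continuous_at_imp_continuous_on)

lemma integral_bump_tendsto:
  assumes g: "g absolutely_integrable_on {s..t}" and "s \<le> t"
  shows "(\<lambda>n. integral {s..t} (\<lambda>x. g x * bump s t n x)) \<longlonglongrightarrow> integral {s..t} g"
proof -
  have meas: "(\<lambda>x. g x * bump s t n x) absolutely_integrable_on {s..t}" for n
  proof -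
    have "(\<lambda>x. bump s t n x * g x) absolutely_integrable_on {s..t}"
    proof (rule absolutely_integrable_bounded_measurable_product_real)
      show "bump s t n \<in> borel_measurable (lebesgue_on {s..t})"
        by (intro continuous_imp_measurable_on_sets_lebesgue continuous_on_subset[OF bump_continuous]) auto
      show "bounded (bump s t n ` {s..t})"
        using bump_range[of s t n] by (auto simp: bounded_iff intro!: exI[of _ 1])
    qed (use g in auto)
    then show ?thesis by (simp add: mult.commute)
  qed
  have "(\<lambda>n. integral ({s..t} - {s, t}) (\<lambda>x. g x * bump s t n x)) \<longlonglongrightarrow> integral ({s..t} - {s, t}) g"
  proof (rule dominated_convergence(2))
    have *: "F integrable_on {s..t} - {s, t}" if "F integrable_on {s..t}" for F :: "real \<Rightarrow> real"
      by (rule integrable_spike_set[OF that]; rule negligible_subset[of "{s, t}"]) auto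
    show "(\<lambda>x. g x * bump s t n x) integrable_on {s..t} - {s, t}" for n
      using meas[of n] by (intro *) (simp add: absolutely_integrable_on_def)
    show "(\<lambda>x. \<bar>g x\<bar>) integrable_on {s..t} - {s, t}"
      using g by (intro *) (simp add: absolutely_integrable_on_def)
    show "norm (g x * bump s t n x) \<le> \<bar>g x\<bar>" for n x
      using bump_range[of s t n x] by (simp add: abs_mult mult_left_le)
    show "(\<lambda>n. g x * bump s t n x) \<longlonglongrightarrow> g x" if "x \<in> {s..t} - {s, t}" for x
      using tendsto_mult[OF tendsto_const bump_tendsto[of x s t], of "g x"] that by auto
  qed
  moreover have "integral ({s..t} - {s, t}) F = integral {s..t} F" for F :: "real \<Rightarrow> real"
    by (rule integral_spike_set; rule negligible_subset[of "{s, t}"]) auto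
  ultimately show ?thesis by simp
qed

lemma bump_support:
  assumes "s \<le> t"
  shows "closure {x. bump s t n x \<noteq> 0} \<subseteq> {s..t}"
proof (rule closure_minimal)
  show "{x. bump s t n x \<noteq> 0} \<subseteq> {s..t}"
  proof
    fix x assume "x \<in> {x. bump s t n x \<noteq> 0}"
    then have "x \<in> {s<..<t}" using bump_outside[OF _ assms, of x n] by blast
    then show "x \<in> {s..t}" by auto
  qed
qed auto

lemma test_function_bump:
  assumes "0 < s" "s \<le> t" "t < 1"
  shows "test_function (bump s t n)"
proof -
  have "bump s t n C1_differentiable_on UNIV"
    unfolding C1_differentiable_on_def
    by (metis bump_C1 has_real_derivative_iff_has_vector_derivative)
  then show ?thesis
    using bump_support[OF assms(2), of n] assms by (auto simp: test_function_def)
qed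

lemma test_functionE:
  assumes "test_function \<phi>"
  obtains D where "deriv \<phi> = D" "\<phi> 0 = 0" "\<phi> 1 = 0" "lip_deriv \<phi> D"
proof -
  from assms obtain D where D: "continuous_on UNIV D" "\<And>x. (\<phi> has_real_derivative D x) (at x)"
    unfolding test_function_def C1_differentiable_on_def has_real_derivative_iff_has_vector_derivative
    by blast
  have z: "\<phi> x = 0" if "x \<notin> Om" for x
  proof (rule ccontr)
    assume "\<phi> x \<noteq> 0"
    then have "x \<in> closure {x. \<phi> x \<noteq> 0}"
      by (intro closure_subset[THEN subsetD]) simp
    then show False
      using assms that unfolding test_function_def by blast
  qed
  have bm: "bdd_meas D"
    using D(1) by (intro bdd_meas_continuous continuous_on_subset[OF D(1)]) auto
  have "\<phi> x = \<phi> 0 + integral {0..x} D" if "x \<in> {0..1}" for x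
  proof -
    have "(D has_integral \<phi> x - \<phi> 0) {0..x}"
      using that D(2) by (intro fundamental_theorem_of_calculus)
        (auto simp: has_real_derivative_iff_has_vector_derivative intro: has_vector_derivative_at_within)
    then show ?thesis by (simp add: integral_unique)
  qed
  then have "lip_deriv \<phi> D"
    using bm unfolding lip_deriv_def by blast
  moreover have "deriv \<phi> = D"
    using D(2) by (intro ext DERIV_imp_deriv)
  ultimately show ?thesis
    using that[of D] z by simp
qed

lemma lip_deriv_has_weak_deriv:
  assumes "lip_deriv v g"
  shows "has_weak_deriv v g"
  unfolding has_weak_deriv_def
proof (intro conjI allI impI)
  have bm: "bdd_meas v" "bdd_meas g"
    using assms lip_deriv_bdd_meas_fun lip_deriv_bdd_meas by auto
  then show "loc_integrable v" "loc_integrable g"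
    by (auto intro: bdd_meas_loc_integrable)
  fix \<phi> assume "test_function \<phi>"
  then obtain D where D: "deriv \<phi> = D" "\<phi> 0 = 0" "\<phi> 1 = 0" "lip_deriv \<phi> D"
    by (rule test_functionE)
  have "(LINT x|leb_Om. v x * deriv \<phi> x) = integral {0..1} (\<lambda>x. v x * D x)"
    unfolding D(1) by (intro LINT_Om_eq_integral bdd_meas_intros bm lip_deriv_bdd_meas[OF D(4)]) simp
  also have "\<dots> = - integral {0..1} (\<lambda>x. g x * \<phi> x)"
    using integral_by_parts_lip[OF assms D(4), of 0 1] D by simp
  also have "integral {0..1} (\<lambda>x. g x * \<phi> x) = (LINT x|leb_Om. g x * \<phi> x)"
    by (intro LINT_Om_eq_integral(2)[symmetric] bdd_meas_intros bm lip_deriv_bdd_meas_fun[OF D(4)]) simp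
  finally show "(LINT x|leb_Om. v x * deriv \<phi> x) = - (LINT x|leb_Om. g x * \<phi> x)" .
qed

lemma AE_leb_Om_if_AE_compact:
  assumes "\<And>s t. 0 < s \<Longrightarrow> s \<le> t \<Longrightarrow> t < 1 \<Longrightarrow> AE x in lebesgue. x \<in> {s..t} \<longrightarrow> P x"
  shows "AE x in leb_Om. P x"
proof -
  have "AE x in lebesgue. x \<in> {1 / (real n + 2)..1 - 1 / (real n + 2)} \<longrightarrow> P x" for n
    by (rule assms) (auto simp: field_simps)
  then have "AE x in lebesgue. \<forall>n. x \<in> {1 / (real n + 2)..1 - 1 / (real n + 2)} \<longrightarrow> P x"
    unfolding AE_all_countable by blast
  then have "AE x in lebesgue. x \<in> Om \<longrightarrow> P x"
  proof eventually_elim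
    case (elim x)
    show "x \<in> Om \<longrightarrow> P x"
    proof
      assume x: "x \<in> Om"
      then obtain n where n: "inverse (real (Suc n)) < min x (1 - x)"
        using reals_Archimedean[of "min x (1 - x)"] by auto
      have "1 / (real n + 2) \<le> inverse (real (Suc n))"
        by (simp add: field_simps)
      with n have "x \<in> {1 / (real n + 2)..1 - 1 / (real n + 2)}" by auto
      with elim show "P x" by blast
    qed
  qed
  then show ?thesis
    by (subst AE_restrict_space_iff) auto
qed

lemma loc_integrable_absolutely_integrable:
  "loc_integrable g \<Longrightarrow> 0 < s \<Longrightarrow> t < 1 \<Longrightarrow> g absolutely_integrable_on {s..t}"
  unfolding loc_integrable_def by (auto simp: subset_eq)

lemma LINT_Om_mult_supported:
  fixes g h :: "real \<Rightarrow> real"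
  assumes g: "g absolutely_integrable_on {s..t}" and st: "0 < s" "t < 1"
    and h: "continuous_on UNIV h" "\<And>x. x \<notin> {s..t} \<Longrightarrow> h x = 0"
  shows "integrable leb_Om (\<lambda>x. g x * h x)"
    and "(LINT x|leb_Om. g x * h x) = integral {s..t} (\<lambda>x. g x * h x)"
proof -
  have "(\<lambda>x. h x * g x) absolutely_integrable_on {s..t}"
  proof (rule absolutely_integrable_bounded_measurable_product_real)
    show "h \<in> borel_measurable (lebesgue_on {s..t})"
      by (intro continuous_imp_measurable_on_sets_lebesgue continuous_on_subset[OF h(1)]) auto
    show "bounded (h ` {s..t})"
      by (intro compact_imp_bounded compact_continuous_image continuous_on_subset[OF h(1)]) auto
  qed (use g in auto)
  then have *: "(\<lambda>x. g x * h x) absolutely_integrable_on {s..t}"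
    by (simp add: mult.commute)
  have "(\<lambda>x. g x * h x) absolutely_integrable_on Om"
    by (rule absolutely_integrable_spike_set_eq[THEN iffD1, OF _ _ *])
       (use st h(2) in \<open>auto intro!: negligible_subset[OF negligible_empty]\<close>)
  then show int: "integrable leb_Om (\<lambda>x. g x * h x)"
    by (simp add: integrable_restrict_space set_integrable_def)
  have "(LINT x|leb_Om. g x * h x) = integral Om (\<lambda>x. g x * h x)"
    using int by (intro lebesgue_integral_eq_integral) auto
  also have "\<dots> = integral {s..t} (\<lambda>x. g x * h x)"
    by (rule integral_spike_set)
       (use st h(2) in \<open>auto intro!: negligible_subset[OF negligible_empty]\<close>)
  finally show "(LINT x|leb_Om. g x * h x) = integral {s..t} (\<lambda>x. g x * h x)" .
qed

text \<open>Testing with bump functions shows that weak derivatives are unique.\<close>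

lemma weak_deriv_unique:
  assumes "has_weak_deriv v g" "has_weak_deriv v h"
  shows "AE x in leb_Om. g x = h x"
proof -
  have "AE x in leb_Om. g x - h x = 0"
  proof (rule AE_leb_Om_if_AE_compact)
    fix p q :: real assume pq: "0 < p" "p \<le> q" "q < 1"
    have loc: "g absolutely_integrable_on {s..t}" "h absolutely_integrable_on {s..t}" if "0 < s" "t < 1" for s t
      using that assms by (auto simp: has_weak_deriv_def loc_integrable_absolutely_integrable)
    show "AE x in lebesgue. x \<in> {p..q} \<longrightarrow> g x - h x = 0"
    proof (rule AE_zero_if_interval_integrals_zero)
      show "(\<lambda>x. g x - h x) absolutely_integrable_on {p..q}"
        using loc pq by (intro set_integral_diff) auto
      fix s t assume st: "p \<le> s" "s \<le> t" "t \<le> q"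
      have l: "g absolutely_integrable_on {s..t}" "h absolutely_integrable_on {s..t}"
        using loc[of s t] st pq by auto
      have d: "(\<lambda>x. g x - h x) absolutely_integrable_on {s..t}"
        using l by (intro set_integral_diff) auto
      have "integral {s..t} (\<lambda>x. (g x - h x) * bump s t n x) = 0" for n
      proof -
        have out: "bump s t n x = 0" if "x \<notin> {s..t}" for x
          using that st by (intro bump_outside) auto
        have test: "test_function (bump s t n)"
          using st pq by (intro test_function_bump) auto
        note L = LINT_Om_mult_supported[OF _ _ _ bump_continuous out, of _]
        have "integral {s..t} (\<lambda>x. (g x - h x) * bump s t n x) = (LINT x|leb_Om. (g x - h x) * bump s t n x)"
          by (rule L(2)[symmetric]) (use d st pq in auto)
        also have "\<dots> = (LINT x|leb_Om. g x * bump s t n x - h x * bump s t n x)"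
          by (simp add: left_diff_distrib)
        also have "\<dots> = (LINT x|leb_Om. g x * bump s t n x) - (LINT x|leb_Om. h x * bump s t n x)"
          by (rule Bochner_Integration.integral_diff; rule L(1)) (use l st pq in auto)
        also have "\<dots> = 0"
          using assms test by (auto simp: has_weak_deriv_def)
        finally show ?thesis .
      qed
      then show "integral {s..t} (\<lambda>x. g x - h x) = 0"
        using integral_bump_tendsto[OF d st(2)] LIMSEQ_unique[OF tendsto_const] by fastforce
    qed
  qed
  then show ?thesis by simp
qed

lemma wderiv_AE_eq:
  assumes "has_weak_deriv v g"
  shows "AE x in leb_Om. wderiv v x = g x"
  using weak_deriv_unique[OF someI[of "has_weak_deriv v", OF assms, folded wderiv_def] assms] .

lemma test_function_primitive:
  fixes \<psi> :: "real \<Rightarrow> real"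
  assumes cont: "continuous_on UNIV \<psi>" and supp: "\<And>x. x \<notin> {s..t} \<Longrightarrow> \<psi> x = 0"
    and mean: "integral {0..1} \<psi> = 0" and st: "0 < s" "s \<le> t" "t < 1"
  obtains \<phi> where "test_function \<phi>" "deriv \<phi> = \<psi>"
proof -
  define \<phi> where "\<phi> x = integral {0..x} \<psi>" for x
  have zero: "integral {x..y} \<psi> = 0" if "\<And>z. z \<in> {x..y} \<Longrightarrow> z \<notin> {s<..<t}" for x y
  proof -
    have "integral {x..y} \<psi> = integral {x..y} (\<lambda>_. 0)"
      by (rule integral_spike[of "{s, t}"]) (use that supp in force)+
    then show ?thesis by simp
  qed
  have out: "\<phi> x = 0" if "x \<notin> {s<..<t}" for x
  proof (cases "x \<le> s")
    case True
    then show ?thesis unfolding \<phi>_def by (intro zero) auto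
  next
    case False
    with that have x: "x \<ge> t" by auto
    have int: "\<psi> integrable_on {a..b}" for a b
      by (intro integrable_continuous_real continuous_on_subset[OF cont]) auto
    show ?thesis
    proof (cases "x \<le> 1")
      case True
      then have "integral {0..x} \<psi> + integral {x..1} \<psi> = integral {0..1} \<psi>"
        using x st by (intro Henstock_Kurzweil_Integration.integral_combine int) auto
      moreover have "integral {x..1} \<psi> = 0" using x by (intro zero) auto
      ultimately show ?thesis using mean by (simp add: \<phi>_def)
    next
      case False
      then have "integral {0..1} \<psi> + integral {1..x} \<psi> = integral {0..x} \<psi>"
        using x st by (intro Henstock_Kurzweil_Integration.integral_combine int) auto
      moreover have "integral {1..x} \<psi> = 0" using st by (intro zero) auto
      ultimately show ?thesis using mean by (simp add: \<phi>_def)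
    qed
  qed
  have der: "(\<phi> has_real_derivative \<psi> x) (at x)" for x
  proof (cases "x \<in> {s..t}")
    case True
    then have "(\<phi> has_real_derivative \<psi> x) (at x within {0..1})"
      unfolding \<phi>_def has_real_derivative_iff_has_vector_derivative using st
      by (intro integral_has_vector_derivative continuous_on_subset[OF cont]) auto
    then show ?thesis
      using True st by (simp add: at_within_Icc_at)
  next
    case False
    have "((\<lambda>_. 0) has_real_derivative \<psi> x) (at x)"
      using supp[OF False] by simp
    then show ?thesis
      by (rule has_field_derivative_transform_within_open[where S = "- {s..t}"])
         (use False out in auto)
  qed
  have "{x. \<phi> x \<noteq> 0} \<subseteq> {s..t}"
  proof
    fix x assume "x \<in> {x. \<phi> x \<noteq> 0}"
    then have "x \<in> {s<..<t}" using out[of x] by blast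
    then show "x \<in> {s..t}" by auto
  qed
  then have "closure {x. \<phi> x \<noteq> 0} \<subseteq> {s..t}"
    by (rule closure_minimal) simp
  then have "test_function \<phi>"
    unfolding test_function_def C1_differentiable_on_def using der cont st
    by (auto simp: has_real_derivative_iff_has_vector_derivative intro!: exI[of _ \<psi>])
  moreover have "deriv \<phi> = \<psi>"
    using der by (intro ext DERIV_imp_deriv)
  ultimately show ?thesis by (rule that)
qed

text \<open>
  The lemma of du Bois-Reymond. The mean of the bump function is removed by subtracting a multiple
  of a fixed bump function \<open>\<omega>\<close>.
\<close>

lemma du_Bois_Reymond:
  assumes k: "bdd_meas k"
    and orth: "\<And>\<phi>. test_function \<phi> \<Longrightarrow> integral {0..1} (\<lambda>x. k x * deriv \<phi> x) = 0"
  obtains \<kappa> where "AE x in leb_Om. k x = \<kappa>"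
proof -
  define \<omega> where "\<omega> = bump (1/4) (3/4) 1"
  have \<omega>c: "continuous_on UNIV \<omega>" unfolding \<omega>_def by (rule bump_continuous)
  have \<omega>0: "\<omega> x = 0" if "x \<notin> {1/4..3/4}" for x
    unfolding \<omega>_def using that by (intro bump_outside) auto
  define m where "m = integral {0..1} \<omega>"
  have "m \<noteq> 0"
  proof
    assume "m = 0"
    have "\<forall>x\<in>{0..1}. \<omega> x = 0"
      using integral_eq_0_iff[of 0 1 \<omega>] \<open>m = 0\<close> bump_range[of "1/4" "3/4" 1] continuous_on_subset[OF \<omega>c, of "{0..1}"]
      by (auto simp: m_def \<omega>_def)
    then have "\<omega> (1/2) = 0" by auto
    then show False by (simp add: \<omega>_def bump_def power2_eq_square)
  qed
  define \<kappa> where "\<kappa> = integral {0..1} (\<lambda>x. k x * \<omega> x) / m"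
  have cb: "bdd_meas h" if "continuous_on UNIV h" for h
    by (intro bdd_meas_continuous continuous_on_subset[OF that]) auto
  have "AE x in leb_Om. k x - \<kappa> = 0"
  proof (rule AE_leb_Om_if_AE_compact)
    fix p q :: real assume pq: "0 < p" "p \<le> q" "q < 1"
    have abs: "(\<lambda>x. k x - \<kappa>) absolutely_integrable_on {s..t}" if "0 \<le> s" "t \<le> 1" for s t
      using bdd_meas_absolutely_integrable[OF bdd_meas_diff[OF k bdd_meas_const[of \<kappa>]]]
      by (rule set_integrable_subset) (use that in auto)
    show "AE x in lebesgue. x \<in> {p..q} \<longrightarrow> k x - \<kappa> = 0"
    proof (rule AE_zero_if_interval_integrals_zero)
      show "(\<lambda>x. k x - \<kappa>) absolutely_integrable_on {p..q}"
        using pq by (intro abs) auto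
      fix s t assume st: "p \<le> s" "s \<le> t" "t \<le> q"
      have "integral {s..t} (\<lambda>x. (k x - \<kappa>) * bump s t n x) = 0" for n
      proof -
        define \<beta> where "\<beta> = bump s t n"
        have \<beta>c: "continuous_on UNIV \<beta>" unfolding \<beta>_def by (rule bump_continuous)
        have \<beta>0: "\<beta> x = 0" if "x \<notin> {s..t}" for x
          unfolding \<beta>_def using that st by (intro bump_outside) auto
        define l where "l = integral {0..1} \<beta>"
        define \<psi> where "\<psi> x = \<beta> x - (l / m) * \<omega> x" for x
        note i = bdd_meas_integrable[of _ 0 1] bdd_meas_intros k cb[OF \<omega>c] cb[OF \<beta>c]
        have "integral {0..1} \<psi> = l - (l / m) * m"
          unfolding \<psi>_def l_def[symmetric] m_def
          by (subst integral_diff) (auto intro!: i simp: l_def)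
        then have mean: "integral {0..1} \<psi> = 0" using \<open>m \<noteq> 0\<close> by simp
        obtain \<phi> where \<phi>: "test_function \<phi>" "deriv \<phi> = \<psi>"
        proof (rule test_function_primitive[of \<psi> "min s (1/4)" "max t (3/4)"])
          show "continuous_on UNIV \<psi>"
            unfolding \<psi>_def by (intro continuous_intros \<beta>c \<omega>c)
          show "\<psi> x = 0" if "x \<notin> {min s (1/4)..max t (3/4)}" for x
          proof -
            have "x \<notin> {s..t}" "x \<notin> {1/4..3/4}"
              using that by (auto simp: min_def max_def split: if_splits)
            then show ?thesis by (simp add: \<psi>_def \<beta>0 \<omega>0)
          qed
        qed (use mean st pq in auto)
        have "0 = integral {0..1} (\<lambda>x. k x * \<psi> x)"
          using orth[OF \<phi>(1)] \<phi>(2) by simp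
        also have "\<dots> = integral {0..1} (\<lambda>x. k x * \<beta> x - (l / m) * (k x * \<omega> x))"
          by (simp add: \<psi>_def algebra_simps)
        also have "\<dots> = integral {0..1} (\<lambda>x. k x * \<beta> x) - (l / m) * integral {0..1} (\<lambda>x. k x * \<omega> x)"
          by (subst integral_diff) (auto intro!: i)
        also have "\<dots> = integral {0..1} (\<lambda>x. k x * \<beta> x) - integral {0..1} (\<lambda>x. \<kappa> * \<beta> x)"
          by (simp add: \<kappa>_def l_def)
        also have "\<dots> = integral {0..1} (\<lambda>x. k x * \<beta> x - \<kappa> * \<beta> x)"
          by (subst integral_diff) (auto intro!: i)
        also have "\<dots> = integral {0..1} (\<lambda>x. (k x - \<kappa>) * \<beta> x)"
          by (simp add: algebra_simps)
        also have "\<dots> = integral {s..t} (\<lambda>x. (k x - \<kappa>) * \<beta> x)"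
          by (rule integral_spike_set)
             (use st pq \<beta>0 in \<open>auto intro!: negligible_subset[OF negligible_empty]\<close>)
        finally show ?thesis by (simp add: \<beta>_def)
      qed
      then show "integral {s..t} (\<lambda>x. k x - \<kappa>) = 0"
        using integral_bump_tendsto[OF abs[of s t] st(2)] LIMSEQ_unique[OF tendsto_const] st pq by fastforce
    qed
  qed
  then show ?thesis by (intro that[of \<kappa>]) simp
qed

lemma W1inf_space_lipschitz_representative:
  assumes "v \<in> W1inf_space"
  obtains w g where "lip_deriv w g" "AE x in leb_Om. v x = w x" "AE x in leb_Om. wderiv v x = g x"
proof -
  from assms obtain g0 where v: "v \<in> Linf_space" and g0: "g0 \<in> Linf_space" "has_weak_deriv v g0"
    by (auto simp: W1inf_space_def)
  obtain v1 where v1: "bdd_meas v1" "AE x in leb_Om. v x = v1 x"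
    using Linf_space_bounded_representative[OF v] .
  obtain g where g: "bdd_meas g" "AE x in leb_Om. g0 x = g x"
    using Linf_space_bounded_representative[OF g0(1)] .
  define G where "G x = 0 + integral {0..x} g" for x
  have G: "lip_deriv G g" unfolding G_def by (rule lip_deriv_primitive[OF g(1)])
  have bG: "bdd_meas G" by (rule lip_deriv_bdd_meas_fun[OF G])
  obtain \<kappa> where \<kappa>: "AE x in leb_Om. v1 x - G x = \<kappa>"
  proof (rule du_Bois_Reymond[of "\<lambda>x. v1 x - G x"])
    show "bdd_meas (\<lambda>x. v1 x - G x)"
      by (intro bdd_meas_intros v1 bG)
    fix \<phi> assume \<phi>: "test_function \<phi>"
    then obtain D where D: "deriv \<phi> = D" "\<phi> 0 = 0" "\<phi> 1 = 0" "lip_deriv \<phi> D"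
      by (rule test_functionE)
    have bD: "bdd_meas D" "bdd_meas \<phi>"
      using D(4) lip_deriv_bdd_meas lip_deriv_bdd_meas_fun by auto
    have "integral {0..1} (\<lambda>x. v1 x * D x) = (LINT x|leb_Om. v x * deriv \<phi> x)"
      using v1(2) by (intro LINT_Om_eq_integral(2)[symmetric] bdd_meas_intros v1 bD) (auto simp: D)
    also have "\<dots> = - (LINT x|leb_Om. g0 x * \<phi> x)"
      using g0(2) \<phi> by (auto simp: has_weak_deriv_def)
    also have "(LINT x|leb_Om. g0 x * \<phi> x) = integral {0..1} (\<lambda>x. g x * \<phi> x)"
      using g(2) by (intro LINT_Om_eq_integral(2) bdd_meas_intros g bD) auto
    also have "- \<dots> = integral {0..1} (\<lambda>x. G x * D x)"
      using integral_by_parts_lip[OF G D(4), of 0 1] D by simp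
    finally have "integral {0..1} (\<lambda>x. v1 x * D x) - integral {0..1} (\<lambda>x. G x * D x) = 0" by simp
    then have "integral {0..1} (\<lambda>x. v1 x * D x - G x * D x) = 0"
      by (subst integral_diff) (auto intro!: bdd_meas_integrable bdd_meas_intros v1 bG bD)
    then show "integral {0..1} (\<lambda>x. (v1 x - G x) * deriv \<phi> x) = 0"
      by (simp add: D algebra_simps)
  qed
  have "lip_deriv (\<lambda>x. \<kappa> + integral {0..x} g) g" by (rule lip_deriv_primitive[OF g(1)])
  moreover have "AE x in leb_Om. v x = \<kappa> + integral {0..x} g"
    using v1(2) \<kappa> by eventually_elim (simp add: G_def)
  moreover have "AE x in leb_Om. wderiv v x = g x"
    using wderiv_AE_eq[OF g0(2)] g(2) by eventually_elim simp
  ultimately show ?thesis by (rule that)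
qed

section \<open>Piecewise linear functions on meshes\<close>

lemma mesh_mono:
  assumes "mesh N X" "i \<le> j" "j \<le> N"
  shows "X i \<le> X j"
  using assms(2,3)
proof (induction j rule: dec_induct)
  case base then show ?case by simp
next
  case (step j)
  have "Suc j \<in> {1..N}" using step by auto
  then have "X j < X (Suc j)"
    using assms(1) unfolding mesh_def by force
  then show ?case using step by auto
qed

lemma mesh_nodes:
  assumes "mesh N X"
  shows "X 0 = 0" "X N = 1" "i \<le> N \<Longrightarrow> X i \<in> {0..1}" "i \<in> {1..N} \<Longrightarrow> X (i - 1) < X i"
proof -
  show *: "X 0 = 0" "X N = 1" and "i \<in> {1..N} \<Longrightarrow> X (i - 1) < X i"
    using assms by (auto simp: mesh_def)
  show "X i \<in> {0..1}" if "i \<le> N"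
    using mesh_mono[OF assms, of 0 i] mesh_mono[OF assms, of i N] that * by auto
qed

lemma mesh_cell_subset:
  assumes "mesh N X" "i \<in> {1..N}"
  shows "0 \<le> X (i - 1)" "X (i - 1) \<le> X i" "X i \<le> 1"
  using mesh_nodes(3)[OF assms(1), of i] mesh_nodes(3)[OF assms(1), of "i - 1"] mesh_nodes(4)[OF assms] assms(2)
  by auto

lemma mesh_cell_disjoint:
  assumes "mesh N X" "i \<in> {1..N}" "j \<in> {1..N}" "x \<in> {X (i - 1)..X i}" "x \<in> {X (j - 1)<..<X j}"
  shows "i = j"
proof (rule ccontr)
  assume "i \<noteq> j"
  then consider "i \<le> j - 1" | "j \<le> i - 1" by linarith
  then show False
  proof cases
    case 1
    then have "X i \<le> X (j - 1)" using assms by (intro mesh_mono) auto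
    then show ?thesis using assms by auto
  next
    case 2
    then have "X j \<le> X (i - 1)" using assms by (intro mesh_mono) auto
    then show ?thesis using assms by auto
  qed
qed

lemma mesh_cell_exists:
  assumes "mesh N X" "N \<ge> 1" "x \<in> {0..1}"
  obtains i where "i \<in> {1..N}" "x \<in> {X (i - 1)..X i}"
proof -
  define i where "i = (LEAST i. x \<le> X i \<and> 1 \<le> i)"
  have ex: "x \<le> X N \<and> 1 \<le> N" using assms mesh_nodes(2)[OF assms(1)] by simp
  have i: "x \<le> X i \<and> 1 \<le> i" unfolding i_def by (rule LeastI[of "\<lambda>i. x \<le> X i \<and> 1 \<le> i", OF ex])
  have "i \<le> N" unfolding i_def by (rule Least_le[of "\<lambda>i. x \<le> X i \<and> 1 \<le> i", OF ex])
  have "X (i - 1) \<le> x"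
  proof (cases "i = 1")
    case True then show ?thesis using mesh_nodes(1)[OF assms(1)] assms by auto
  next
    case False
    then have "\<not> (x \<le> X (i - 1) \<and> 1 \<le> i - 1)"
      using i unfolding i_def by (intro not_less_Least) auto
    then show ?thesis using False i by auto
  qed
  then show ?thesis using i \<open>i \<le> N\<close> by (intro that[of i]) auto
qed

lemma mesh_open_cell_exists:
  assumes "mesh N X" "N \<ge> 1" "x \<in> {0..1}" "x \<notin> X ` {0..N}"
  obtains i where "i \<in> {1..N}" "x \<in> {X (i - 1)<..<X i}"
proof -
  obtain i where i: "i \<in> {1..N}" "x \<in> {X (i - 1)..X i}"
    using mesh_cell_exists[OF assms(1-3)] .
  moreover have "x \<noteq> X (i - 1)" "x \<noteq> X i" using assms(4) i by auto
  ultimately show ?thesis by (intro that[of i]) auto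
qed

text \<open>
  The piecewise constant function with values \<open>p 1, \<dots>, p N\<close> on the open cells of a mesh; it
  vanishes at the nodes.
\<close>

definition piecewise_const :: "nat \<Rightarrow> (nat \<Rightarrow> real) \<Rightarrow> (nat \<Rightarrow> real) \<Rightarrow> real \<Rightarrow> real" where
  "piecewise_const N X p x = (\<Sum>i\<in>{1..N}. p i * indicator {X (i - 1)<..<X i} x)"

text \<open>The difference quotient of \<open>v\<close> over the \<open>i\<close>-th cell.\<close>

definition slope :: "(nat \<Rightarrow> real) \<Rightarrow> (real \<Rightarrow> real) \<Rightarrow> nat \<Rightarrow> real" where
  "slope X v i = (v (X i) - v (X (i - 1))) / (X i - X (i - 1))"

text \<open>
  For a finite element function \<open>v\<close> this is its derivative; for a general \<open>v\<close> it is the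
  derivative of the piecewise linear interpolant.
\<close>

abbreviation fe_deriv :: "nat \<Rightarrow> (nat \<Rightarrow> real) \<Rightarrow> (real \<Rightarrow> real) \<Rightarrow> real \<Rightarrow> real" where
  "fe_deriv N X v \<equiv> piecewise_const N X (slope X v)"

lemma bdd_meas_piecewise_const: "bdd_meas (piecewise_const N X p)"
  unfolding piecewise_const_def by (intro bdd_meas_intros) auto

lemma piecewise_const_cell:
  assumes "mesh N X" "i \<in> {1..N}" "x \<in> {X (i - 1)<..<X i}"
  shows "piecewise_const N X p x = p i"
proof -
  have "piecewise_const N X p x = (\<Sum>j\<in>{1..N}. if j = i then p i else 0)"
    unfolding piecewise_const_def
  proof (rule sum.cong[OF refl])
    fix j assume j: "j \<in> {1..N}"
    show "p j * indicator {X (j - 1)<..<X j} x = (if j = i then p i else 0)"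
    proof (cases "x \<in> {X (j - 1)<..<X j}")
      case True
      then have "i = j" using mesh_cell_disjoint[OF assms(1,2) j, of x] assms(3) by simp
      then show ?thesis using True by simp
    next
      case False
      then have "j \<noteq> i" using assms by auto
      then show ?thesis using False by simp
    qed
  qed
  also have "\<dots> = p i" using assms by simp
  finally show ?thesis .
qed

lemma piecewise_const_node:
  assumes "mesh N X" "j \<le> N"
  shows "piecewise_const N X p (X j) = 0"
proof -
  have "X j \<notin> {X (i - 1)<..<X i}" if "i \<in> {1..N}" for i
  proof (cases "j \<le> i - 1")
    case True
    then have "X j \<le> X (i - 1)" using that assms by (intro mesh_mono) auto
    then show ?thesis by auto
  next
    case False
    then have "X i \<le> X j" using that assms by (intro mesh_mono) auto
    then show ?thesis by auto
  qed
  then show ?thesis unfolding piecewise_const_def by (intro sum.neutral) auto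
qed

lemma piecewise_const_bound:
  assumes "mesh N X" "N \<ge> 1" "\<And>i. i \<in> {1..N} \<Longrightarrow> \<bar>p i\<bar> \<le> M" "M \<ge> 0" "x \<in> {0..1}"
  shows "\<bar>piecewise_const N X p x\<bar> \<le> M"
proof (cases "x \<in> X ` {0..N}")
  case True
  then show ?thesis using piecewise_const_node[OF assms(1)] assms(4) by auto
next
  case False
  then obtain i where "i \<in> {1..N}" "x \<in> {X (i - 1)<..<X i}"
    using mesh_open_cell_exists[OF assms(1,2,5)] by blast
  then show ?thesis using piecewise_const_cell[OF assms(1)] assms(3) by auto
qed

lemma integral_sum_cells:
  assumes "mesh N X" "bdd_meas q"
  shows "integral {0..1} q = (\<Sum>i\<in>{1..N}. integral {X (i - 1)..X i} q)"
proof -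
  have "integral {0..X n} q = (\<Sum>i\<in>{1..n}. integral {X (i - 1)..X i} q)" if "n \<le> N" for n
    using that
  proof (induction n)
    case 0
    then show ?case using mesh_nodes(1)[OF assms(1)] by simp
  next
    case (Suc n)
    have n: "Suc n \<in> {1..N}" using Suc by auto
    have "integral {0..X n} q + integral {X n..X (Suc n)} q = integral {0..X (Suc n)} q"
      using mesh_cell_subset[OF assms(1) n]
      by (intro Henstock_Kurzweil_Integration.integral_combine bdd_meas_integrable assms) auto
    then show ?case using Suc by simp
  qed
  from this[of N] show ?thesis using mesh_nodes(2)[OF assms(1)] by simp
qed

lemma integral_mult_piecewise_const:
  assumes "mesh N X" "bdd_meas q"
  shows "integral {0..1} (\<lambda>x. q x * piecewise_const N X p x)
    = (\<Sum>i\<in>{1..N}. p i * integral {X (i - 1)..X i} q)"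
proof -
  have "integral {X (i - 1)..X i} (\<lambda>x. q x * piecewise_const N X p x) = p i * integral {X (i - 1)..X i} q"
    if i: "i \<in> {1..N}" for i
  proof -
    have "integral {X (i - 1)..X i} (\<lambda>x. q x * piecewise_const N X p x) = integral {X (i - 1)..X i} (\<lambda>x. p i * q x)"
    proof (rule integral_spike[of "{X (i - 1), X i}"])
      fix x assume "x \<in> {X (i - 1)..X i} - {X (i - 1), X i}"
      then have "x \<in> {X (i - 1)<..<X i}" by auto
      from piecewise_const_cell[OF assms(1) i this]
      show "p i * q x = q x * piecewise_const N X p x" by simp
    qed auto
    then show ?thesis by simp
  qed
  then show ?thesis
    by (subst integral_sum_cells[OF assms(1)])
       (auto intro!: bdd_meas_intros assms bdd_meas_piecewise_const)
qed

lemma integral_abs_piecewise_const: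
  assumes "mesh N X"
  shows "integral {0..1} (\<lambda>x. \<bar>piecewise_const N X p x\<bar>)
    = (\<Sum>i\<in>{1..N}. \<bar>p i\<bar> * (X i - X (i - 1)))"
proof -
  have "integral {X (i - 1)..X i} (\<lambda>x. \<bar>piecewise_const N X p x\<bar>) = \<bar>p i\<bar> * (X i - X (i - 1))"
    if i: "i \<in> {1..N}" for i
  proof -
    have "integral {X (i - 1)..X i} (\<lambda>x. \<bar>piecewise_const N X p x\<bar>) = integral {X (i - 1)..X i} (\<lambda>x. \<bar>p i\<bar>)"
    proof (rule integral_spike[of "{X (i - 1), X i}"])
      fix x assume "x \<in> {X (i - 1)..X i} - {X (i - 1), X i}"
      then have "x \<in> {X (i - 1)<..<X i}" by auto
      from piecewise_const_cell[OF assms(1) i this]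
      show "\<bar>p i\<bar> = \<bar>piecewise_const N X p x\<bar>" by simp
    qed auto
    then show ?thesis using mesh_cell_subset[OF assms(1) i] by simp
  qed
  then show ?thesis
    by (subst integral_sum_cells[OF assms])
       (auto intro!: bdd_meas_intros bdd_meas_piecewise_const)
qed

lemma affine_on_closed_cell:
  fixes v :: "real \<Rightarrow> real"
  assumes "continuous_on {l..r} v" "l < r" "\<And>x. x \<in> {l<..<r} \<Longrightarrow> v x = p + q * x" "x \<in> {l..r}"
  shows "v x = p + q * x"
proof -
  have "v x - (p + q * x) = 0"
    by (rule continuous_constant_on_closure[of "{l<..<r}"])
       (use assms in \<open>auto intro!: continuous_intros\<close>)
  then show ?thesis by simp
qed

lemma fe_space_lip_deriv:
  assumes X: "mesh N X" "N \<ge> 1" and v: "v \<in> fe_space N X"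
  shows "lip_deriv v (fe_deriv N X v)"
proof -
  have cont: "continuous_on {0..1} v" using v by (auto simp: fe_space_def)
  have der: "(v has_vector_derivative fe_deriv N X v x) (at x)"
    if x: "x \<in> {0..1}" "x \<notin> X ` {0..N}" for x
  proof -
    obtain i where i: "i \<in> {1..N}" "x \<in> {X (i - 1)<..<X i}"
      using mesh_open_cell_exists[OF X x] .
    obtain p q where pq: "\<And>x. x \<in> {X (i - 1)<..<X i} \<Longrightarrow> v x = p + q * x"
      using v i(1) unfolding fe_space_def by blast
    note cell = mesh_cell_subset[OF X(1) i(1)] mesh_nodes(4)[OF X(1) i(1)]
    have "v y = p + q * y" if "y \<in> {X (i - 1)..X i}" for y
      by (rule affine_on_closed_cell[OF continuous_on_subset[OF cont] cell(4) pq that]) (use cell in auto)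
    then have "v (X i) = p + q * X i" "v (X (i - 1)) = p + q * X (i - 1)"
      using cell by auto
    then have "slope X v i = q"
      using cell by (simp add: slope_def field_simps)
    then have "fe_deriv N X v x = q"
      using piecewise_const_cell[OF X(1) i] by simp
    moreover have "(v has_real_derivative q) (at x)"
    proof (rule has_field_derivative_transform_within_open[where S = "{X (i - 1)<..<X i}"])
      show "((\<lambda>x. p + q * x) has_real_derivative q) (at x)"
        by (auto intro!: derivative_eq_intros)
    qed (use i pq in auto)
    ultimately show ?thesis
      by (simp add: has_real_derivative_iff_has_vector_derivative)
  qed
  have "v x = v 0 + integral {0..x} (fe_deriv N X v)" if x: "x \<in> {0..1}" for x
  proof -
    have "(fe_deriv N X v has_integral v x - v 0) {0..x}"
    proof (rule fundamental_theorem_of_calculus_interior_strong[of "X ` {0..N}"])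
      show "continuous_on {0..x} v" using x by (intro continuous_on_subset[OF cont]) auto
      show "(v has_vector_derivative fe_deriv N X v y) (at y)" if "y \<in> {0<..<x} - X ` {0..N}" for y
        using that x by (intro der) auto
    qed (use x in auto)
    then show ?thesis by (simp add: integral_unique)
  qed
  then show ?thesis
    using bdd_meas_piecewise_const unfolding lip_deriv_def by blast
qed

text \<open>The piecewise linear interpolant of a function that vanishes at \<open>0\<close>.\<close>

definition interpolant :: "nat \<Rightarrow> (nat \<Rightarrow> real) \<Rightarrow> (real \<Rightarrow> real) \<Rightarrow> real \<Rightarrow> real" where
  "interpolant N X v x = 0 + integral {0..x} (fe_deriv N X v)"

lemma interpolant_lip_deriv: "lip_deriv (interpolant N X v) (fe_deriv N X v)"
  unfolding interpolant_def by (rule lip_deriv_primitive[OF bdd_meas_piecewise_const])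

lemma interpolant_cell:
  assumes "mesh N X" "i \<in> {1..N}" "x \<in> {X (i - 1)..X i}"
  shows "interpolant N X v x = interpolant N X v (X (i - 1)) + slope X v i * (x - X (i - 1))"
proof -
  note cell = mesh_cell_subset[OF assms(1,2)]
  have "interpolant N X v x - interpolant N X v (X (i - 1)) = integral {X (i - 1)..x} (fe_deriv N X v)"
    using assms cell by (intro lip_deriv_increment[OF interpolant_lip_deriv]) auto
  also have "\<dots> = integral {X (i - 1)..x} (\<lambda>_. slope X v i)"
  proof (rule integral_spike[of "{X (i - 1), x}"])
    fix y assume "y \<in> {X (i - 1)..x} - {X (i - 1), x}"
    then have "y \<in> {X (i - 1)<..<X i}" using assms by auto
    from piecewise_const_cell[OF assms(1,2) this]
    show "slope X v i = fe_deriv N X v y" by simp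
  qed auto
  also have "\<dots> = slope X v i * (x - X (i - 1))"
    using assms by simp
  finally show ?thesis by simp
qed

lemma interpolant_node:
  assumes "mesh N X" "v 0 = 0" "i \<le> N"
  shows "interpolant N X v (X i) = v (X i)"
  using assms(3)
proof (induction i)
  case 0
  then show ?case using mesh_nodes(1)[OF assms(1)] assms(2) by (simp add: interpolant_def)
next
  case (Suc i)
  have i: "Suc i \<in> {1..N}" using Suc by auto
  note cell = mesh_nodes(4)[OF assms(1) i]
  have "interpolant N X v (X (Suc i)) = v (X i) + slope X v (Suc i) * (X (Suc i) - X i)"
    using interpolant_cell[OF assms(1) i, of "X (Suc i)" v] Suc cell by simp
  also have "\<dots> = v (X (Suc i))"
    using cell by (simp add: slope_def)
  finally show ?case .
qed

lemma fe_deriv_cong: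
  assumes "\<And>i. i \<le> N \<Longrightarrow> v (X i) = w (X i)"
  shows "fe_deriv N X v = fe_deriv N X w"
  unfolding piecewise_const_def slope_def using assms by (intro ext sum.cong) auto

lemma interpolant_fe_space:
  assumes X: "mesh N X" and v: "v 0 = 0" "v 1 = 0"
  shows "interpolant N X v \<in> fe_space N X" "fe_deriv N X (interpolant N X v) = fe_deriv N X v"
proof -
  show "fe_deriv N X (interpolant N X v) = fe_deriv N X v"
    using interpolant_node[of N X v] X v(1) by (intro fe_deriv_cong) auto
  have "interpolant N X v 0 = 0" by (simp add: interpolant_def)
  moreover have "interpolant N X v 1 = 0"
    using interpolant_node[of N X v N] X mesh_nodes(2)[OF X] v by simp
  moreover have "\<exists>p q. \<forall>x\<in>{X (i - 1)<..<X i}. interpolant N X v x = p + q * x" if i: "i \<in> {1..N}" for i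
  proof (intro exI ballI)
    fix x assume "x \<in> {X (i - 1)<..<X i}"
    then show "interpolant N X v x
      = (interpolant N X v (X (i - 1)) - slope X v i * X (i - 1)) + slope X v i * x"
      using interpolant_cell[OF X i, of x v] by (simp add: algebra_simps)
  qed
  ultimately show "interpolant N X v \<in> fe_space N X"
    using lip_deriv_continuous[OF interpolant_lip_deriv] unfolding fe_space_def by blast
qed

lemma fe_space_diff:
  assumes "v \<in> fe_space N X" "w \<in> fe_space N X"
  shows "(\<lambda>x. v x - w x) \<in> fe_space N X"
proof -
  have "\<exists>p q. \<forall>x\<in>{X (i - 1)<..<X i}. v x - w x = p + q * x" if i: "i \<in> {1..N}" for i
  proof -
    obtain p q where "\<forall>x\<in>{X (i - 1)<..<X i}. v x = p + q * x"
      using assms(1) i unfolding fe_space_def by blast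
    moreover obtain p' q' where "\<forall>x\<in>{X (i - 1)<..<X i}. w x = p' + q' * x"
      using assms(2) i unfolding fe_space_def by blast
    ultimately have "\<forall>x\<in>{X (i - 1)<..<X i}. v x - w x = (p - p') + (q - q') * x"
      by (simp add: algebra_simps)
    then show ?thesis by blast
  qed
  then show ?thesis
    using assms by (auto simp: fe_space_def intro!: continuous_intros)
qed

lemma fe_deriv_diff:
  "fe_deriv N X (\<lambda>x. v x - w x) = (\<lambda>x. fe_deriv N X v x - fe_deriv N X w x)"
proof -
  have "slope X (\<lambda>x. v x - w x) i = slope X v i - slope X w i" for i
    by (simp add: slope_def diff_divide_distrib)
  then show ?thesis
    by (simp add: piecewise_const_def fun_eq_iff left_diff_distrib sum_subtractf)
qed

text \<open>
  The node-preserving map from one mesh to another moves no point by more than the largest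
  displacement of a node, and a Lipschitz function that is linear on the cells of the second mesh
  becomes linear on the cells of the first.
\<close>

lemma interpolation_error_nearby_mesh:
  assumes X: "mesh N X" and Y: "mesh N Y" and N: "N \<ge> 1" and u: "u \<in> fe_space N Y"
    and near: "\<And>i. i \<le> N \<Longrightarrow> \<bar>X i - Y i\<bar> \<le> \<delta>"
    and M: "\<And>x. x \<in> {0..1} \<Longrightarrow> \<bar>fe_deriv N Y u x\<bar> \<le> M" and x: "x \<in> {0..1}"
  shows "\<bar>u x - interpolant N X u x\<bar> \<le> 2 * M * \<delta>"
proof -
  have u01: "u 0 = 0" "u 1 = 0" using u by (auto simp: fe_space_def)
  have lip: "\<bar>u t - u s\<bar> \<le> M * \<delta>" if "s \<in> {0..1}" "t \<in> {0..1}" "\<bar>t - s\<bar> \<le> \<delta>" for s t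
  proof -
    have "\<bar>u t - u s\<bar> \<le> M * \<bar>t - s\<bar>"
      using lip_deriv_bound[OF fe_space_lip_deriv[OF Y N u] that(1,2) M] .
    also have "\<dots> \<le> M * \<delta>"
      using that(3) M[of 0] by (intro mult_left_mono) auto
    finally show ?thesis .
  qed
  obtain i where i: "i \<in> {1..N}" "x \<in> {X (i - 1)..X i}"
    using mesh_cell_exists[OF X N x] .
  note cX = mesh_cell_subset[OF X i(1)] mesh_nodes(4)[OF X i(1)]
  note cY = mesh_cell_subset[OF Y i(1)] mesh_nodes(4)[OF Y i(1)]
  define \<mu> where "\<mu> = (x - X (i - 1)) / (X i - X (i - 1))"
  have "\<mu> * (X i - X (i - 1)) = x - X (i - 1)"
    using cX by (simp add: \<mu>_def)
  then have "x = (1 - \<mu>) * X (i - 1) + \<mu> * X i"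
    by (simp add: algebra_simps)
  moreover have "0 \<le> \<mu>" "\<mu> \<le> 1"
    using i cX by (auto simp: \<mu>_def divide_le_eq)
  ultimately have \<mu>: "0 \<le> \<mu>" "\<mu> \<le> 1" "x = (1 - \<mu>) * X (i - 1) + \<mu> * X i" by auto
  define y where "y = (1 - \<mu>) * Y (i - 1) + \<mu> * Y i"
  have conv: "(1 - \<mu>) * s + \<mu> * t \<le> r" if "s \<le> r" "t \<le> r" for s t r :: real
    using mult_left_mono[OF that(1), of "1 - \<mu>"] mult_left_mono[OF that(2), of \<mu>] \<mu>
    by (simp add: algebra_simps)
  have y: "y \<in> {Y (i - 1)..Y i}"
    using conv[of "Y (i - 1)" "Y i" "Y i"] conv[of "- Y (i - 1)" "- Y (i - 1)" "- Y i"] cY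
    by (auto simp: y_def algebra_simps)
  have near': "\<bar>X (i - 1) - Y (i - 1)\<bar> \<le> \<delta>" "\<bar>X i - Y i\<bar> \<le> \<delta>"
    using i near by auto
  have "\<bar>x - y\<bar> = \<bar>(1 - \<mu>) * (X (i - 1) - Y (i - 1)) + \<mu> * (X i - Y i)\<bar>"
    by (simp add: \<mu>(3) y_def algebra_simps)
  also have "\<dots> \<le> (1 - \<mu>) * \<bar>X (i - 1) - Y (i - 1)\<bar> + \<mu> * \<bar>X i - Y i\<bar>"
    using \<mu> by (intro abs_triangle_ineq[THEN order_trans]) (auto simp: abs_mult)
  also have "\<dots> \<le> \<delta>" using near' by (rule conv)
  finally have xy: "\<bar>x - y\<bar> \<le> \<delta>" .
  have "u \<in> fe_space N Y" by fact
  then obtain p q where pq: "\<And>z. z \<in> {Y (i - 1)<..<Y i} \<Longrightarrow> u z = p + q * z"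
    using i unfolding fe_space_def by blast
  have aff: "u z = p + q * z" if "z \<in> {Y (i - 1)..Y i}" for z
    by (rule affine_on_closed_cell[OF _ cY(4) pq that])
       (use u cY in \<open>auto simp: fe_space_def intro: continuous_on_subset\<close>)
  have uy: "u y = (1 - \<mu>) * u (Y (i - 1)) + \<mu> * u (Y i)"
    using aff[OF y] aff[of "Y i"] aff[of "Y (i - 1)"] cY by (simp add: y_def algebra_simps)
  have "interpolant N X u x = u (X (i - 1)) + slope X u i * (x - X (i - 1))"
    using interpolant_cell[OF X i] interpolant_node[of N X u "i - 1"] X u01(1) i by auto
  also have "\<dots> = (1 - \<mu>) * u (X (i - 1)) + \<mu> * u (X i)"
    by (simp add: slope_def \<mu>_def algebra_simps diff_divide_distrib)
  finally have "u x - interpolant N X u x = (u x - u y)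
      + ((1 - \<mu>) * (u (Y (i - 1)) - u (X (i - 1))) + \<mu> * (u (Y i) - u (X i)))"
    by (simp add: uy algebra_simps)
  also have "\<bar>\<dots>\<bar> \<le> \<bar>u x - u y\<bar>
      + ((1 - \<mu>) * \<bar>u (Y (i - 1)) - u (X (i - 1))\<bar> + \<mu> * \<bar>u (Y i) - u (X i)\<bar>)"
    using \<mu> by (intro abs_triangle_ineq[THEN order_trans] add_left_mono) (auto simp: abs_mult)
  also have "\<dots> \<le> M * \<delta> + M * \<delta>"
    using xy y x cX cY near'
    by (intro add_mono conv lip) (auto simp: abs_minus_commute)
  finally show ?thesis by simp
qed

lemma piecewise_const_no_node:
  assumes "\<And>i. i \<le> N \<Longrightarrow> X i \<notin> {l<..<r}" "x \<in> {l<..<r}" "y \<in> {l<..<r}"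
  shows "piecewise_const N X p x = piecewise_const N X p y"
  unfolding piecewise_const_def
proof (rule sum.cong[OF refl])
  fix i assume "i \<in> {1..N}"
  then have "X i \<notin> {l<..<r}" "X (i - 1) \<notin> {l<..<r}" using assms(1) by auto
  then have "x \<in> {X (i - 1)<..<X i} \<longleftrightarrow> y \<in> {X (i - 1)<..<X i}"
    using assms(2,3) by auto
  then show "p i * indicator {X (i - 1)<..<X i} x = p i * indicator {X (i - 1)<..<X i} y"
    by (simp add: indicator_def)
qed

text \<open>
  The total variation of a piecewise linear function is at most twice its maximum for each of its
  linear pieces.
\<close>

lemma total_variation_piecewise_linear:
  assumes e: "lip_deriv e g" and \<eta>: "\<And>x. x \<in> {0..1} \<Longrightarrow> \<bar>e x\<bar> \<le> \<eta>" and S: "finite S"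
    and const: "\<And>l r x y. {l<..<r} \<inter> S = {} \<Longrightarrow> x \<in> {l<..<r} \<Longrightarrow> y \<in> {l<..<r} \<Longrightarrow> g x = g y"
    and st: "0 \<le> s" "s \<le> t" "t \<le> 1"
  shows "integral {s..t} (\<lambda>x. \<bar>g x\<bar>) \<le> 2 * \<eta> * (real (card ({s<..<t} \<inter> S)) + 1)"
  using st
proof (induction "card ({s<..<t} \<inter> S)" arbitrary: s t rule: less_induct)
  case (less s t)
  have bm: "bdd_meas g" by (rule lip_deriv_bdd_meas[OF e])
  have "\<eta> \<ge> 0" using \<eta>[of 0] by auto
  show ?case
  proof (cases "{s<..<t} \<inter> S = {}")
    case True
    define k where "k = g ((s + t) / 2)"
    have k: "g x = k" if "x \<in> {s<..<t}" for x
      unfolding k_def using that by (intro const[OF True]) auto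
    have "integral {s..t} (\<lambda>x. \<bar>g x\<bar>) = integral {s..t} (\<lambda>x. \<bar>k\<bar>)"
      by (rule integral_spike[of "{s, t}"]) (use k in auto)
    also have "\<dots> = \<bar>integral {s..t} (\<lambda>x. k)\<bar>"
      using less.prems by (simp add: abs_mult)
    also have "integral {s..t} (\<lambda>x. k) = integral {s..t} g"
      by (rule integral_spike[of "{s, t}"]) (use k in auto)
    also have "\<bar>\<dots>\<bar> = \<bar>e t - e s\<bar>"
      using lip_deriv_increment[OF e less.prems] by simp
    also have "\<dots> \<le> 2 * \<eta>"
      using \<eta>[of s] \<eta>[of t] less.prems by auto
    finally show ?thesis using True by simp
  next
    case False
    then obtain z where z: "z \<in> {s<..<t}" "z \<in> S" by blast
    let ?A = "{s<..<z} \<inter> S" and ?B = "{z<..<t} \<inter> S"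
    have fin: "finite ?A" "finite ?B" "finite ({s<..<t} \<inter> S)" using S by auto
    have "card (insert z (?A \<union> ?B)) \<le> card ({s<..<t} \<inter> S)"
      using z fin by (intro card_mono) auto
    moreover have "card (insert z (?A \<union> ?B)) = Suc (card ?A + card ?B)"
      using fin by (subst card_insert_disjoint) (auto intro!: card_Un_disjoint)
    ultimately have card: "card ?A + card ?B + 1 \<le> card ({s<..<t} \<inter> S)" by simp
    have "integral {s..t} (\<lambda>x. \<bar>g x\<bar>) = integral {s..z} (\<lambda>x. \<bar>g x\<bar>) + integral {z..t} (\<lambda>x. \<bar>g x\<bar>)"
      using z less.prems
      by (intro Henstock_Kurzweil_Integration.integral_combine[symmetric] bdd_meas_integrable bdd_meas_abs bm) auto
    also have "\<dots> \<le> 2 * \<eta> * (real (card ?A) + 1) + 2 * \<eta> * (real (card ?B) + 1)"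
      using card z less.prems by (intro add_mono less.hyps) auto
    also have "\<dots> = 2 * \<eta> * (real (card ?A + card ?B + 1) + 1)"
      by (simp add: algebra_simps)
    also have "\<dots> \<le> 2 * \<eta> * (real (card ({s<..<t} \<inter> S)) + 1)"
      using card \<open>\<eta> \<ge> 0\<close> by (intro mult_left_mono add_right_mono) linarith+
    finally show ?thesis .
  qed
qed

section \<open>Stability of finite element solutions under mesh perturbation\<close>

text \<open>The \<open>L\<^sup>1\<close> norm on the unit interval, used for derivatives.\<close>

definition l1_norm :: "(real \<Rightarrow> real) \<Rightarrow> real" where
  "l1_norm g = integral {0..1} (\<lambda>x. \<bar>g x\<bar>)"

lemma l1_norm_nonneg: "bdd_meas g \<Longrightarrow> l1_norm g \<ge> 0"
  unfolding l1_norm_def by (intro integral_nonneg bdd_meas_integrable bdd_meas_abs) auto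

text \<open>
  The coefficients are bounded by \<open>K\<close> at every point; \<open>A\<close> and \<open>b\<close> are Lipschitz with
  derivatives \<open>A'\<close> and \<open>b'\<close>, and the two sign conditions hold at every point.
\<close>

locale convection_diffusion =
  fixes A A' b b' c f :: "real \<Rightarrow> real" and a0 K :: real
  assumes A: "lip_deriv A A'" and b: "lip_deriv b b'" and c: "bdd_meas c" and f: "bdd_meas f"
    and a0: "a0 > 0" and A_ge: "\<And>x. x \<in> {0..1} \<Longrightarrow> A x \<ge> a0"
    and nonneg: "\<And>x. x \<in> {0..1} \<Longrightarrow> c x - b' x / 2 \<ge> 0"
    and bounds: "\<And>x. x \<in> {0..1} \<Longrightarrow> \<bar>A x\<bar> \<le> K" "\<And>x. x \<in> {0..1} \<Longrightarrow> \<bar>A' x\<bar> \<le> K"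
      "\<And>x. x \<in> {0..1} \<Longrightarrow> \<bar>b x\<bar> \<le> K" "\<And>x. x \<in> {0..1} \<Longrightarrow> \<bar>b' x\<bar> \<le> K"
      "\<And>x. x \<in> {0..1} \<Longrightarrow> \<bar>c x\<bar> \<le> K" "\<And>x. x \<in> {0..1} \<Longrightarrow> \<bar>f x\<bar> \<le> K"
begin

lemma coeffs_bdd_meas: "bdd_meas A" "bdd_meas A'" "bdd_meas b" "bdd_meas b'" "bdd_meas c" "bdd_meas f"
  using lip_deriv_bdd_meas_fun[OF A] lip_deriv_bdd_meas[OF A] lip_deriv_bdd_meas_fun[OF b]
    lip_deriv_bdd_meas[OF b] c f by auto

lemma K_nonneg: "K \<ge> 0"
  using bounds(1)[of 0] by auto

text \<open>
  The bilinear form, with the derivatives \<open>u'\<close> and \<open>v'\<close> as separate arguments.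
\<close>

definition form :: "(real \<Rightarrow> real) \<Rightarrow> (real \<Rightarrow> real) \<Rightarrow> (real \<Rightarrow> real) \<Rightarrow> (real \<Rightarrow> real) \<Rightarrow> real" where
  "form u u' v v' = integral {0..1} (\<lambda>x. A x * u' x * v' x + b x * u' x * v x + c x * u x * v x)"

text \<open>The finite element equations in terms of \<open>form\<close>.\<close>

definition galerkin :: "nat \<Rightarrow> (nat \<Rightarrow> real) \<Rightarrow> (real \<Rightarrow> real) \<Rightarrow> bool" where
  "galerkin N X u \<longleftrightarrow> u \<in> fe_space N X \<and>
     (\<forall>v\<in>fe_space N X. form u (fe_deriv N X u) v (fe_deriv N X v) = integral {0..1} (\<lambda>x. f x * v x))"

lemma form_diff:
  assumes "bdd_meas u" "bdd_meas u'" "bdd_meas w" "bdd_meas w'" "bdd_meas v" "bdd_meas v'"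
  shows "form (\<lambda>x. u x - w x) (\<lambda>x. u' x - w' x) v v' = form u u' v v' - form w w' v v'"
  unfolding form_def
  by (subst integral_diff[symmetric])
     (auto intro!: bdd_meas_integrable bdd_meas_intros coeffs_bdd_meas assms simp: algebra_simps)

text \<open>Integration by parts turns \<open>b w' w\<close> into \<open>- b' w\<^sup>2 / 2\<close>.\<close>

lemma form_energy:
  assumes w: "lip_deriv w g" and z: "w 0 = 0" "w 1 = 0"
  shows "form w g w g = integral {0..1} (\<lambda>x. A x * (g x)\<^sup>2 + (c x - b' x / 2) * (w x)\<^sup>2)"
proof -
  have bm: "bdd_meas w" "bdd_meas g" using lip_deriv_bdd_meas_fun[OF w] lip_deriv_bdd_meas[OF w] by auto
  note i = bdd_meas_integrable[of _ 0 1] bdd_meas_intros coeffs_bdd_meas bm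
  have "integral {0..1} (\<lambda>x. b x * (g x * w x + w x * g x)) = - integral {0..1} (\<lambda>x. b' x * (w x * w x))"
    using integral_by_parts_lip[OF b lip_deriv_mult[OF w w], of 0 1] z by simp
  moreover have "integral {0..1} (\<lambda>x. b x * (g x * w x + w x * g x)) = 2 * integral {0..1} (\<lambda>x. b x * g x * w x)"
    by (subst integral_mult_right[symmetric], rule integral_cong) (simp add: algebra_simps)
  moreover have "integral {0..1} (\<lambda>x. b' x * (w x * w x)) = 2 * integral {0..1} (\<lambda>x. b' x / 2 * (w x)\<^sup>2)"
    by (subst integral_mult_right[symmetric], rule integral_cong) (simp add: power2_eq_square)
  ultimately have 1: "integral {0..1} (\<lambda>x. b x * g x * w x) = - integral {0..1} (\<lambda>x. b' x / 2 * (w x)\<^sup>2)"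
    by simp
  have "form w g w g = integral {0..1} (\<lambda>x. (A x * (g x)\<^sup>2 + c x * (w x)\<^sup>2) + b x * g x * w x)"
    unfolding form_def by (rule integral_cong) (simp add: power2_eq_square algebra_simps)
  also have "\<dots> = integral {0..1} (\<lambda>x. A x * (g x)\<^sup>2 + c x * (w x)\<^sup>2) + integral {0..1} (\<lambda>x. b x * g x * w x)"
    by (intro integral_add; intro i; simp)
  also have "\<dots> = integral {0..1} (\<lambda>x. A x * (g x)\<^sup>2 + c x * (w x)\<^sup>2) - integral {0..1} (\<lambda>x. b' x / 2 * (w x)\<^sup>2)"
    using 1 by simp
  also have "\<dots> = integral {0..1} (\<lambda>x. (A x * (g x)\<^sup>2 + c x * (w x)\<^sup>2) - b' x / 2 * (w x)\<^sup>2)"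
    by (intro integral_diff[symmetric]; intro i; simp)
  also have "\<dots> = integral {0..1} (\<lambda>x. A x * (g x)\<^sup>2 + (c x - b' x / 2) * (w x)\<^sup>2)"
    by (rule integral_cong) (simp add: algebra_simps)
  finally show ?thesis .
qed

lemma energy_nonneg:
  assumes "bdd_meas w" "bdd_meas g"
  shows "0 \<le> integral {0..1} (\<lambda>x. A x * (g x)\<^sup>2 + (c x - b' x / 2) * (w x)\<^sup>2)"
proof (rule integral_nonneg)
  show "(\<lambda>x. A x * (g x)\<^sup>2 + (c x - b' x / 2) * (w x)\<^sup>2) integrable_on {0..1}"
    by (intro bdd_meas_integrable bdd_meas_intros coeffs_bdd_meas assms) auto
  fix x :: real assume "x \<in> {0..1}"
  then have "0 \<le> A x" "0 \<le> c x - b' x / 2"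
    using A_ge[of x] a0 nonneg[of x] by auto
  then show "0 \<le> A x * (g x)\<^sup>2 + (c x - b' x / 2) * (w x)\<^sup>2"
    by (intro add_nonneg_nonneg mult_nonneg_nonneg) auto
qed

text \<open>Coercivity in the weaker \<open>W\<^sup>1\<^sup>,\<^sup>1\<close> seminorm, which also bounds the maximum norm.\<close>

lemma coercive:
  assumes w: "lip_deriv w g" and z: "w 0 = 0" "w 1 = 0"
  shows "a0 * (l1_norm g)\<^sup>2 \<le> form w g w g"
proof -
  have bm: "bdd_meas w" "bdd_meas g" using lip_deriv_bdd_meas_fun[OF w] lip_deriv_bdd_meas[OF w] by auto
  have "a0 * (l1_norm g)\<^sup>2 \<le> a0 * integral {0..1} (\<lambda>x. (g x)\<^sup>2)"
    using integral_abs_square_le[OF bm(2)] a0 unfolding l1_norm_def by (intro mult_left_mono) auto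
  also have "\<dots> = integral {0..1} (\<lambda>x. a0 * (g x)\<^sup>2)" by simp
  also have "\<dots> \<le> integral {0..1} (\<lambda>x. A x * (g x)\<^sup>2 + (c x - b' x / 2) * (w x)\<^sup>2)"
  proof (rule integral_le)
    fix x :: real assume x: "x \<in> {0..1}"
    have "a0 * (g x)\<^sup>2 \<le> A x * (g x)\<^sup>2" using A_ge[OF x] by (intro mult_right_mono) auto
    moreover have "0 \<le> (c x - b' x / 2) * (w x)\<^sup>2" using nonneg[OF x] by (intro mult_nonneg_nonneg) auto
    ultimately show "a0 * (g x)\<^sup>2 \<le> A x * (g x)\<^sup>2 + (c x - b' x / 2) * (w x)\<^sup>2" by linarith
  qed (auto intro!: bdd_meas_integrable bdd_meas_intros coeffs_bdd_meas bm)
  finally show ?thesis using form_energy[OF assms] by simp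
qed

lemma l1_norm_le_if_form_le:
  assumes w: "lip_deriv w g" "w 0 = 0" "w 1 = 0" and le: "form w g w g \<le> B * l1_norm g"
  shows "l1_norm g \<le> B / a0 \<or> l1_norm g = 0"
proof (cases "l1_norm g = 0")
  case False
  then have pos: "l1_norm g > 0" using l1_norm_nonneg[OF lip_deriv_bdd_meas[OF w(1)]] by simp
  have "(a0 * l1_norm g) * l1_norm g \<le> B * l1_norm g"
    using coercive[OF w] le by (simp add: power2_eq_square mult.assoc)
  then have "a0 * l1_norm g \<le> B" using pos by simp
  then show ?thesis using a0 by (simp add: field_simps)
qed simp

text \<open>
  The flux is \<open>A u'\<close> plus a primitive of the load \<open>f - b u' - c u\<close>. For the solution of
  the boundary value problem it would be constant, so its deviation from the mean is a measure of
  the residual.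
\<close>

definition load :: "(real \<Rightarrow> real) \<Rightarrow> (real \<Rightarrow> real) \<Rightarrow> real \<Rightarrow> real" where
  "load u u' x = f x - b x * u' x - c x * u x"

definition load_primitive :: "(real \<Rightarrow> real) \<Rightarrow> (real \<Rightarrow> real) \<Rightarrow> real \<Rightarrow> real" where
  "load_primitive u u' x = 0 + integral {0..x} (load u u')"

definition flux :: "(real \<Rightarrow> real) \<Rightarrow> (real \<Rightarrow> real) \<Rightarrow> real \<Rightarrow> real" where
  "flux u u' x = A x * u' x + load_primitive u u' x"

definition flux_defect :: "(real \<Rightarrow> real) \<Rightarrow> (real \<Rightarrow> real) \<Rightarrow> real \<Rightarrow> real" where
  "flux_defect u u' x = flux u u' x - integral {0..1} (flux u u')"

context
  fixes u u' :: "real \<Rightarrow> real"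
  assumes u: "lip_deriv u u'"
begin

lemma u_bdd_meas: "bdd_meas u" "bdd_meas u'"
  using lip_deriv_bdd_meas_fun[OF u] lip_deriv_bdd_meas[OF u] by auto

lemma load_bdd_meas: "bdd_meas (load u u')"
  unfolding load_def by (intro bdd_meas_intros coeffs_bdd_meas u_bdd_meas)

lemma load_primitive_lip: "lip_deriv (load_primitive u u') (load u u')"
  unfolding load_primitive_def by (rule lip_deriv_primitive[OF load_bdd_meas])

lemma flux_bdd_meas: "bdd_meas (flux u u')"
  unfolding flux_def
  by (intro bdd_meas_intros coeffs_bdd_meas u_bdd_meas lip_deriv_bdd_meas_fun[OF load_primitive_lip])

lemma flux_defect_bdd_meas: "bdd_meas (flux_defect u u')"
  unfolding flux_defect_def by (intro bdd_meas_intros flux_bdd_meas)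

lemma flux_defect_mean: "integral {0..1} (flux_defect u u') = 0"
  unfolding flux_defect_def
  by (subst integral_diff) (auto intro!: bdd_meas_integrable bdd_meas_intros flux_bdd_meas)

text \<open>Subtracting a constant from the flux changes nothing, as \<open>v'\<close> has mean zero.\<close>

lemma residual_eq_flux_defect:
  assumes v: "lip_deriv v v'" "v 0 = 0" "v 1 = 0"
  shows "integral {0..1} (\<lambda>x. f x * v x) - form u u' v v' = - integral {0..1} (\<lambda>x. flux_defect u u' x * v' x)"
proof -
  have bm: "bdd_meas v" "bdd_meas v'" using lip_deriv_bdd_meas_fun[OF v(1)] lip_deriv_bdd_meas[OF v(1)] by auto
  have bp: "bdd_meas (load_primitive u u')" by (rule lip_deriv_bdd_meas_fun[OF load_primitive_lip])
  note i = bdd_meas_integrable[of _ 0 1] bdd_meas_intros coeffs_bdd_meas bm u_bdd_meas load_bdd_meas bp flux_bdd_meas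
  let ?k = "integral {0..1} (flux u u')"
  have "integral {0..1} (\<lambda>x. f x * v x) - form u u' v v'
      = integral {0..1} (\<lambda>x. f x * v x - (A x * u' x * v' x + b x * u' x * v x + c x * u x * v x))"
    unfolding form_def by (intro integral_diff[symmetric]; intro i; simp)
  also have "\<dots> = integral {0..1} (\<lambda>x. load u u' x * v x - A x * u' x * v' x)"
    by (rule integral_cong) (simp add: load_def algebra_simps)
  also have "\<dots> = integral {0..1} (\<lambda>x. load u u' x * v x) - integral {0..1} (\<lambda>x. A x * u' x * v' x)"
    by (intro integral_diff; intro i; simp)
  also have "integral {0..1} (\<lambda>x. load u u' x * v x) = - integral {0..1} (\<lambda>x. load_primitive u u' x * v' x)"
    using integral_by_parts_lip[OF load_primitive_lip v(1), of 0 1] v by simp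
  also have "- integral {0..1} (\<lambda>x. load_primitive u u' x * v' x) - integral {0..1} (\<lambda>x. A x * u' x * v' x)
      = - (integral {0..1} (\<lambda>x. load_primitive u u' x * v' x) + integral {0..1} (\<lambda>x. A x * u' x * v' x))"
    by simp
  also have "integral {0..1} (\<lambda>x. load_primitive u u' x * v' x) + integral {0..1} (\<lambda>x. A x * u' x * v' x)
      = integral {0..1} (\<lambda>x. load_primitive u u' x * v' x + A x * u' x * v' x)"
    by (intro integral_add[symmetric]; intro i; simp)
  also have "\<dots> = integral {0..1} (\<lambda>x. flux_defect u u' x * v' x + ?k * v' x)"
    by (rule integral_cong) (simp add: flux_defect_def flux_def algebra_simps)
  also have "\<dots> = integral {0..1} (\<lambda>x. flux_defect u u' x * v' x) + integral {0..1} (\<lambda>x. ?k * v' x)"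
    by (intro integral_add; intro i flux_defect_bdd_meas; simp)
  also have "integral {0..1} (\<lambda>x. ?k * v' x) = ?k * (v 1 - v 0)"
    using lip_deriv_increment[OF v(1), of 0 1] by simp
  finally show ?thesis using v by simp
qed

end

lemma galerkin_lip:
  "galerkin N Y u \<Longrightarrow> mesh N Y \<Longrightarrow> N \<ge> 1 \<Longrightarrow> lip_deriv u (fe_deriv N Y u)"
  "galerkin N Y u \<Longrightarrow> u 0 = 0" "galerkin N Y u \<Longrightarrow> u 1 = 0"
  by (auto simp: galerkin_def intro: fe_space_lip_deriv) (auto simp: fe_space_def)

text \<open>
  Galerkin orthogonality says that the flux defect has mean zero on every cell: test with the
  interpolant of its primitive.
\<close>

lemma flux_defect_cell_mean:
  assumes u: "galerkin N Y u" and Y: "mesh N Y" "N \<ge> 1" and j: "j \<in> {1..N}"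
  shows "integral {Y (j - 1)..Y j} (flux_defect u (fe_deriv N Y u)) = 0"
proof -
  note lu = galerkin_lip(1)[OF u Y]
  let ?R = "flux_defect u (fe_deriv N Y u)"
  note bR = flux_defect_bdd_meas[OF lu]
  define Q where "Q x = 0 + integral {0..x} ?R" for x
  have Q: "lip_deriv Q ?R" unfolding Q_def by (rule lip_deriv_primitive[OF bR])
  have Q01: "Q 0 = 0" "Q 1 = 0" using flux_defect_mean[OF lu] by (auto simp: Q_def)
  let ?v = "interpolant N Y Q"
  have v: "?v \<in> fe_space N Y" and dv: "fe_deriv N Y ?v = fe_deriv N Y Q"
    using interpolant_fe_space[of N Y Q, OF Y(1) Q01] by auto
  have v01: "?v 0 = 0" "?v 1 = 0" using v by (auto simp: fe_space_def)
  have "integral {0..1} (\<lambda>x. ?R x * fe_deriv N Y Q x) = 0"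
    using residual_eq_flux_defect[OF lu interpolant_lip_deriv v01] u v dv by (auto simp: galerkin_def)
  then have "(\<Sum>i\<in>{1..N}. slope Y Q i * integral {Y (i - 1)..Y i} ?R) = 0"
    using integral_mult_piecewise_const[OF Y(1) bR] by simp
  moreover have inc: "Q (Y i) - Q (Y (i - 1)) = integral {Y (i - 1)..Y i} ?R" if "i \<in> {1..N}" for i
    using mesh_cell_subset[OF Y(1) that] by (intro lip_deriv_increment[OF Q]) auto
  ultimately have "(\<Sum>i\<in>{1..N}. (integral {Y (i - 1)..Y i} ?R)\<^sup>2 / (Y i - Y (i - 1))) = 0"
    by (simp add: slope_def power2_eq_square)
  then have "(integral {Y (j - 1)..Y j} ?R)\<^sup>2 / (Y j - Y (j - 1)) = 0"
    using j mesh_nodes(4)[OF Y(1)] by (subst (asm) sum_nonneg_eq_0_iff) (auto simp: less_imp_le)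
  then show ?thesis using mesh_nodes(4)[OF Y(1) j] by auto
qed

text \<open>
  Mesh-independent bounds for finite element solutions: \<open>stab\<close> for the maximum norm and for the
  \<open>L\<^sup>1\<close> norm of the derivative, \<open>grad_bound\<close> for the maximum norm of the derivative.
\<close>

definition stab :: real where
  "stab = K / a0"

definition grad_bound :: real where
  "grad_bound = (2 * (K + K * stab + K * stab) + K * stab) / a0"

lemma stab_nonneg: "stab \<ge> 0" using K_nonneg a0 by (simp add: stab_def)

lemma grad_bound_nonneg: "grad_bound \<ge> 0"
  unfolding grad_bound_def using K_nonneg a0 stab_nonneg by (intro divide_nonneg_pos add_nonneg_nonneg mult_nonneg_nonneg) auto

lemma galerkin_stab:
  assumes u: "galerkin N Y u" and Y: "mesh N Y" "N \<ge> 1"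
  shows "l1_norm (fe_deriv N Y u) \<le> stab" "x \<in> {0..1} \<Longrightarrow> \<bar>u x\<bar> \<le> stab"
proof -
  note lu = galerkin_lip(1)[OF u Y] and u01 = galerkin_lip(2,3)[OF u]
  let ?g = "fe_deriv N Y u"
  have u_le: "\<bar>u x\<bar> \<le> l1_norm ?g" if "x \<in> {0..1}" for x
    unfolding l1_norm_def by (rule lip_deriv_abs_le[OF lu u01(1) that])
  have "form u ?g u ?g = integral {0..1} (\<lambda>x. f x * u x)"
    using u by (auto simp: galerkin_def)
  also have "\<dots> \<le> \<bar>integral {0..1} (\<lambda>x. f x * u x)\<bar>" by simp
  also have "\<dots> \<le> (K * l1_norm ?g) * (1 - 0)"
  proof (rule bdd_meas_abs_integral_le[where S = "{}"])
    fix x :: real assume x: "0 \<le> x" "x \<le> 1"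
    show "\<bar>f x * u x\<bar> \<le> K * l1_norm ?g"
      unfolding abs_mult using x bounds u_le K_nonneg by (intro mult_mono) auto
  qed (use K_nonneg l1_norm_nonneg[OF bdd_meas_piecewise_const] in
       \<open>auto intro!: bdd_meas_intros coeffs_bdd_meas lip_deriv_bdd_meas_fun[OF lu]\<close>)
  finally have "l1_norm ?g \<le> stab \<or> l1_norm ?g = 0"
    unfolding stab_def by (intro l1_norm_le_if_form_le[OF lu u01]) simp
  then show "l1_norm ?g \<le> stab" using stab_nonneg by auto
  then show "\<bar>u x\<bar> \<le> stab" if "x \<in> {0..1}" using u_le[OF that] by simp
qed

text \<open>
  On a cell, the flux has the same mean as on the whole interval, and \<open>u'\<close> is constant. So
  \<open>u'\<close> times the mean of \<open>A\<close> is the difference of two quantities that are controlled by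
  the \<open>W\<^sup>1\<^sup>,\<^sup>1\<close> stability of \<open>u\<close>.
\<close>

lemma galerkin_grad_bound:
  assumes u: "galerkin N Y u" and Y: "mesh N Y" "N \<ge> 1" and x: "x \<in> {0..1}"
  shows "\<bar>fe_deriv N Y u x\<bar> \<le> grad_bound"
proof (rule piecewise_const_bound[OF Y _ grad_bound_nonneg x])
  fix j assume j: "j \<in> {1..N}"
  note lu = galerkin_lip(1)[OF u Y]
  let ?g = "fe_deriv N Y u" let ?L = "load_primitive u (fe_deriv N Y u)" let ?F = "flux u (fe_deriv N Y u)"
  note bL = lip_deriv_bdd_meas_fun[OF load_primitive_lip[OF lu]]
  note bg = bdd_meas_piecewise_const[of N Y "slope Y u"]
  note cell = mesh_cell_subset[OF Y(1) j] mesh_nodes(4)[OF Y(1) j]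
  define h where "h = Y j - Y (j - 1)"
  define \<Phi> where "\<Phi> = K + K * stab + K * stab"
  have h: "h > 0" using cell by (simp add: h_def)
  have \<Phi>0: "\<Phi> \<ge> 0" unfolding \<Phi>_def using K_nonneg stab_nonneg by auto
  have stab: "l1_norm ?g \<le> stab" "\<And>x. x \<in> {0..1} \<Longrightarrow> \<bar>u x\<bar> \<le> stab"
    using galerkin_stab[OF u Y] by auto
  have AL: "\<bar>integral {0..1} (\<lambda>x. A x * ?g x)\<bar> \<le> K * stab"
    using integral_abs_mult_le[OF coeffs_bdd_meas(1) bg bounds(1), of 0 1] stab(1) K_nonneg
      mult_left_mono[OF stab(1) K_nonneg] by (auto simp: l1_norm_def)
  have L: "\<bar>?L y\<bar> \<le> \<Phi>" if y: "y \<in> {0..1}" for y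
  proof -
    note i = bdd_meas_integrable[of _ 0 y] bdd_meas_intros coeffs_bdd_meas bg lip_deriv_bdd_meas_fun[OF lu]
    have "?L y = integral {0..y} (\<lambda>x. (f x - c x * u x) - b x * ?g x)"
      unfolding load_primitive_def load_def by (simp add: algebra_simps)
    also have "\<dots> = integral {0..y} (\<lambda>x. f x - c x * u x) - integral {0..y} (\<lambda>x. b x * ?g x)"
      using y by (intro integral_diff; intro i) auto
    finally have "\<bar>?L y\<bar> \<le> \<bar>integral {0..y} (\<lambda>x. f x - c x * u x)\<bar> + \<bar>integral {0..y} (\<lambda>x. b x * ?g x)\<bar>"
      by simp
    also have "\<dots> \<le> (K + K * stab) + K * stab"
    proof (rule add_mono)
      have "\<bar>integral {0..y} (\<lambda>x. f x - c x * u x)\<bar> \<le> (K + K * stab) * (y - 0)"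
      proof (rule bdd_meas_abs_integral_le[where S = "{}"])
        fix x assume "0 \<le> x" "x \<le> y"
        then have x: "x \<in> {0..1}" using y by auto
        have "\<bar>c x * u x\<bar> \<le> K * stab"
          unfolding abs_mult using bounds(5)[OF x] stab(2)[OF x] K_nonneg by (intro mult_mono) auto
        then show "\<bar>f x - c x * u x\<bar> \<le> K + K * stab"
          using bounds(6)[OF x] by linarith
      qed (use y K_nonneg stab_nonneg in \<open>auto intro!: i\<close>)
      also have "\<dots> \<le> K + K * stab"
        using y K_nonneg stab_nonneg by (simp add: mult_left_le)
      finally show "\<bar>integral {0..y} (\<lambda>x. f x - c x * u x)\<bar> \<le> K + K * stab" .
      have "\<bar>integral {0..y} (\<lambda>x. b x * ?g x)\<bar> \<le> K * integral {0..y} (\<lambda>x. \<bar>?g x\<bar>)"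
        using y by (intro integral_abs_mult_le coeffs_bdd_meas bg bounds) auto
      also have "\<dots> \<le> K * l1_norm ?g"
        unfolding l1_norm_def using y K_nonneg by (intro mult_left_mono integral_mono_subset bdd_meas_abs bg) auto
      also have "\<dots> \<le> K * stab" using stab(1) K_nonneg by (rule mult_left_mono)
      finally show "\<bar>integral {0..y} (\<lambda>x. b x * ?g x)\<bar> \<le> K * stab" .
    qed
    finally show ?thesis by (simp add: \<Phi>_def)
  qed
  define \<kappa> where "\<kappa> = integral {0..1} ?F"
  have "\<kappa> = integral {0..1} (\<lambda>x. A x * ?g x) + integral {0..1} ?L"
    unfolding \<kappa>_def flux_def
    by (intro integral_add bdd_meas_integrable bdd_meas_intros coeffs_bdd_meas bg bL) auto
  moreover have "\<bar>integral {0..1} ?L\<bar> \<le> \<Phi> * (1 - 0)"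
    using L \<Phi>0 bL by (intro bdd_meas_abs_integral_le[where S = "{}"]) auto
  ultimately have \<kappa>: "\<bar>\<kappa>\<bar> \<le> K * stab + \<Phi>"
    using abs_triangle_ineq[of "integral {0..1} (\<lambda>x. A x * ?g x)" "integral {0..1} ?L"] AL by simp
  note i = bdd_meas_integrable[of _ "Y (j - 1)" "Y j"] bdd_meas_intros coeffs_bdd_meas bg bL
  have "0 = integral {Y (j - 1)..Y j} (flux_defect u ?g)"
    using flux_defect_cell_mean[OF u Y j] by simp
  also have "\<dots> = integral {Y (j - 1)..Y j} (\<lambda>x. A x * ?g x - (\<kappa> - ?L x))"
    unfolding flux_defect_def \<kappa>_def[symmetric] by (rule integral_cong) (simp add: flux_def)
  also have "\<dots> = integral {Y (j - 1)..Y j} (\<lambda>x. slope Y u j * A x - (\<kappa> - ?L x))"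
  proof (rule integral_spike[of "{Y (j - 1), Y j}"])
    fix x assume "x \<in> {Y (j - 1)..Y j} - {Y (j - 1), Y j}"
    then have "x \<in> {Y (j - 1)<..<Y j}" by auto
    from piecewise_const_cell[OF Y(1) j this]
    show "slope Y u j * A x - (\<kappa> - ?L x) = A x * ?g x - (\<kappa> - ?L x)" by simp
  qed auto
  also have "\<dots> = integral {Y (j - 1)..Y j} (\<lambda>x. slope Y u j * A x) - integral {Y (j - 1)..Y j} (\<lambda>x. \<kappa> - ?L x)"
    using cell by (intro integral_diff; intro i) auto
  finally have eq: "slope Y u j * integral {Y (j - 1)..Y j} A = integral {Y (j - 1)..Y j} (\<lambda>x. \<kappa> - ?L x)"
    by simp
  have "\<bar>integral {Y (j - 1)..Y j} (\<lambda>x. \<kappa> - ?L x)\<bar> \<le> (2 * \<Phi> + K * stab) * h"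
    unfolding h_def
  proof (rule bdd_meas_abs_integral_le[where S = "{}"])
    fix x assume "Y (j - 1) \<le> x" "x \<le> Y j"
    then have "x \<in> {0..1}" using cell by auto
    then show "\<bar>\<kappa> - ?L x\<bar> \<le> 2 * \<Phi> + K * stab" using \<kappa> L[of x] by linarith
  qed (use cell \<Phi>0 K_nonneg stab_nonneg in \<open>auto intro!: i\<close>)
  moreover have "a0 * h \<le> integral {Y (j - 1)..Y j} A"
  proof -
    have "integral {Y (j - 1)..Y j} (\<lambda>x. a0) \<le> integral {Y (j - 1)..Y j} A"
      using cell A_ge by (intro integral_le i) auto
    then show ?thesis using cell by (simp add: h_def mult.commute)
  qed
  then have "\<bar>slope Y u j\<bar> * (a0 * h) \<le> \<bar>slope Y u j * integral {Y (j - 1)..Y j} A\<bar>"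
    unfolding abs_mult by (intro mult_left_mono) auto
  ultimately have "\<bar>slope Y u j\<bar> * a0 * h \<le> (2 * \<Phi> + K * stab) * h"
    unfolding eq by (simp add: mult.assoc)
  then have "\<bar>slope Y u j\<bar> * a0 \<le> 2 * \<Phi> + K * stab" using h by simp
  then show "\<bar>slope Y u j\<bar> \<le> grad_bound"
    using a0 by (simp add: grad_bound_def \<Phi>_def pos_le_divide_eq)
qed

text \<open>A Lipschitz constant of the flux defect on each cell.\<close>

definition defect_lip :: real where
  "defect_lip = K * grad_bound + (K + K * grad_bound + K * stab)"

lemma defect_lip_nonneg: "defect_lip \<ge> 0"
  unfolding defect_lip_def using K_nonneg grad_bound_nonneg stab_nonneg by auto

text \<open>Having mean zero on a cell, the flux defect is bounded by its oscillation there.\<close>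

lemma flux_defect_bound:
  assumes u: "galerkin N Y u" and Y: "mesh N Y" "N \<ge> 1" and j: "j \<in> {1..N}"
    and x: "x \<in> {Y (j - 1)<..<Y j}"
  shows "\<bar>flux_defect u (fe_deriv N Y u) x\<bar> \<le> defect_lip * (Y j - Y (j - 1))"
proof -
  note lu = galerkin_lip(1)[OF u Y]
  let ?g = "fe_deriv N Y u" let ?L = "load_primitive u (fe_deriv N Y u)"
  let ?R = "flux_defect u (fe_deriv N Y u)"
  note cell = mesh_cell_subset[OF Y(1) j] mesh_nodes(4)[OF Y(1) j]
  define h where "h = Y j - Y (j - 1)"
  have h: "h > 0" using cell by (simp add: h_def)
  have load: "\<bar>load u ?g z\<bar> \<le> K + K * grad_bound + K * stab" if z: "z \<in> {0..1}" for z
  proof -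
    have "\<bar>b z * ?g z\<bar> \<le> K * grad_bound"
      unfolding abs_mult using bounds(3)[OF z] galerkin_grad_bound[OF u Y z] K_nonneg by (intro mult_mono) auto
    moreover have "\<bar>c z * u z\<bar> \<le> K * stab"
      unfolding abs_mult using bounds(5)[OF z] galerkin_stab(2)[OF u Y z] K_nonneg by (intro mult_mono) auto
    ultimately show ?thesis using bounds(6)[OF z] unfolding load_def by linarith
  qed
  have osc: "\<bar>?R x - ?R y\<bar> \<le> defect_lip * h" if y: "y \<in> {Y (j - 1)<..<Y j}" for y
  proof -
    have xy: "x \<in> {0..1}" "y \<in> {0..1}" "\<bar>x - y\<bar> \<le> h" using x y cell by (auto simp: h_def)
    have gx: "?g x = slope Y u j" "?g y = slope Y u j"
      using piecewise_const_cell[OF Y(1) j] x y by auto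
    have "?R x - ?R y = (A x - A y) * ?g x + (?L x - ?L y)"
      unfolding flux_defect_def flux_def gx by (simp add: left_diff_distrib)
    then have "\<bar>?R x - ?R y\<bar> \<le> \<bar>A x - A y\<bar> * \<bar>?g x\<bar> + \<bar>?L x - ?L y\<bar>"
      using abs_triangle_ineq[of "(A x - A y) * ?g x" "?L x - ?L y"] by (simp only: abs_mult)
    also have "\<dots> \<le> (K * \<bar>x - y\<bar>) * grad_bound + (K + K * grad_bound + K * stab) * \<bar>x - y\<bar>"
    proof (rule add_mono)
      have "\<bar>A x - A y\<bar> \<le> K * \<bar>x - y\<bar>"
        by (rule lip_deriv_bound[OF A xy(2,1) bounds(2)])
      then show "\<bar>A x - A y\<bar> * \<bar>?g x\<bar> \<le> (K * \<bar>x - y\<bar>) * grad_bound"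
        using galerkin_grad_bound[OF u Y xy(1)] K_nonneg by (intro mult_mono) simp_all
      show "\<bar>?L x - ?L y\<bar> \<le> (K + K * grad_bound + K * stab) * \<bar>x - y\<bar>"
        by (rule lip_deriv_bound[OF load_primitive_lip[OF lu] xy(2,1) load])
    qed
    also have "\<dots> = defect_lip * \<bar>x - y\<bar>" by (simp add: defect_lip_def algebra_simps)
    also have "\<dots> \<le> defect_lip * h" using xy defect_lip_nonneg by (intro mult_left_mono) auto
    finally show ?thesis .
  qed
  have "\<bar>integral {Y (j - 1)..Y j} (\<lambda>y. ?R x - ?R y)\<bar> \<le> (defect_lip * h) * (Y j - Y (j - 1))"
  proof (rule bdd_meas_abs_integral_le[where S = "{Y (j - 1), Y j}"])
    fix y assume "Y (j - 1) \<le> y" "y \<le> Y j" "y \<notin> {Y (j - 1), Y j}"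
    then show "\<bar>?R x - ?R y\<bar> \<le> defect_lip * h" by (intro osc) auto
  qed (use cell h defect_lip_nonneg in
       \<open>simp_all add: bdd_meas_diff bdd_meas_const flux_defect_bdd_meas[OF lu]\<close>)
  moreover have "integral {Y (j - 1)..Y j} (\<lambda>y. ?R x - ?R y) = h * ?R x - integral {Y (j - 1)..Y j} ?R"
    using cell by (subst integral_diff)
      (auto simp: h_def intro!: bdd_meas_integrable bdd_meas_intros flux_defect_bdd_meas[OF lu])
  ultimately have "\<bar>h * ?R x\<bar> \<le> defect_lip * h * h"
    using flux_defect_cell_mean[OF u Y j] unfolding h_def[symmetric] by simp
  then have "h * \<bar>?R x\<bar> \<le> h * (defect_lip * h)"
    using h by (simp only: abs_mult abs_of_pos mult_ac)
  then have "\<bar>?R x\<bar> \<le> defect_lip * h"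
    using h by (rule mult_left_le_imp_le)
  then show ?thesis unfolding h_def .
qed

text \<open>
  The finite element solution on \<open>Y\<close> almost solves the equations on \<open>X\<close>. The flux
  defect is of order \<open>1 / N\<close>, and its primitive \<open>Q\<close> vanishes at the nodes of \<open>Y\<close>, hence is of size
  \<open>\<delta> / N\<close> at those of \<open>X\<close>; as \<open>v'\<close> is constant on the cells of \<open>X\<close>,
  only these nodal values enter. The lower bound on the cells of \<open>X\<close> absorbs the factor
  \<open>1 / N\<close>.
\<close>

lemma consistency_error:
  assumes u: "galerkin N Y u" and Y: "mesh N Y" and X: "mesh N X" and N: "N \<ge> 1"
    and Ymax: "\<And>i. i \<in> {1..N} \<Longrightarrow> Y i - Y (i - 1) \<le> 2 / real N"
    and Xmin: "\<And>i. i \<in> {1..N} \<Longrightarrow> 1 / (\<rho> * real N) \<le> X i - X (i - 1)" and \<rho>: "\<rho> > 0"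
    and near: "\<And>i. i \<le> N \<Longrightarrow> \<bar>X i - Y i\<bar> \<le> \<delta>"
    and v: "v \<in> fe_space N X"
  shows "\<bar>integral {0..1} (\<lambda>x. f x * v x) - form u (fe_deriv N Y u) v (fe_deriv N X v)\<bar>
    \<le> 4 * defect_lip * \<rho> * \<delta> * l1_norm (fe_deriv N X v)"
proof -
  note lu = galerkin_lip(1)[OF u Y N]
  let ?R = "flux_defect u (fe_deriv N Y u)"
  note bR = flux_defect_bdd_meas[OF lu]
  have v01: "v 0 = 0" "v 1 = 0" using v by (auto simp: fe_space_def)
  define Q where "Q x = 0 + integral {0..x} ?R" for x
  have Q: "lip_deriv Q ?R" unfolding Q_def by (rule lip_deriv_primitive[OF bR])
  have QY: "Q (Y j) = 0" if "j \<le> N" for j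
    using that
  proof (induction j)
    case 0 then show ?case using mesh_nodes(1)[OF Y] by (simp add: Q_def)
  next
    case (Suc j)
    have j: "Suc j \<in> {1..N}" using Suc by auto
    have "Q (Y (Suc j)) - Q (Y j) = integral {Y j..Y (Suc j)} ?R"
      using mesh_cell_subset[OF Y j] by (intro lip_deriv_increment[OF Q]) auto
    then show ?case using flux_defect_cell_mean[OF u Y N j] Suc by simp
  qed
  define B where "B = defect_lip * (2 / real N)"
  have B0: "B \<ge> 0" using defect_lip_nonneg by (simp add: B_def)
  have RB: "\<bar>?R x\<bar> \<le> B" if x: "x \<in> {0..1}" "x \<notin> Y ` {0..N}" for x
  proof -
    obtain j where j: "j \<in> {1..N}" "x \<in> {Y (j - 1)<..<Y j}"
      using mesh_open_cell_exists[OF Y N x] by blast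
    have "\<bar>?R x\<bar> \<le> defect_lip * (Y j - Y (j - 1))" by (rule flux_defect_bound[OF u Y N j])
    also have "\<dots> \<le> B" unfolding B_def using Ymax[OF j(1)] defect_lip_nonneg by (rule mult_left_mono)
    finally show ?thesis .
  qed
  have QX: "\<bar>Q (X i)\<bar> \<le> B * \<delta>" if i: "i \<le> N" for i
  proof -
    have *: "\<bar>integral {s..t} ?R\<bar> \<le> B * (t - s)" if "s \<in> {0..1}" "t \<in> {0..1}" "s \<le> t" for s t
      using that RB B0 by (intro bdd_meas_abs_integral_le[where S = "Y ` {0..N}"] bR) auto
    have "\<bar>Q (X i) - Q (Y i)\<bar> \<le> B * \<bar>X i - Y i\<bar>"
    proof (cases "X i \<le> Y i")
      case True
      then show ?thesis
        using lip_deriv_increment[OF Q, of "X i" "Y i"] *[of "X i" "Y i"]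
          mesh_nodes(3)[OF X i] mesh_nodes(3)[OF Y i] by (auto simp: abs_minus_commute)
    next
      case False
      then show ?thesis
        using lip_deriv_increment[OF Q, of "Y i" "X i"] *[of "Y i" "X i"]
          mesh_nodes(3)[OF X i] mesh_nodes(3)[OF Y i] by auto
    qed
    also have "\<dots> \<le> B * \<delta>" using near[OF i] B0 by (rule mult_left_mono)
    finally show ?thesis using QY[OF i] by simp
  qed
  have "\<bar>integral {0..1} (\<lambda>x. f x * v x) - form u (fe_deriv N Y u) v (fe_deriv N X v)\<bar>
      = \<bar>\<Sum>i\<in>{1..N}. slope X v i * integral {X (i - 1)..X i} ?R\<bar>"
    using residual_eq_flux_defect[OF lu fe_space_lip_deriv[OF X N v] v01]
      integral_mult_piecewise_const[OF X bR, of "slope X v"] by simp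
  also have "\<dots> \<le> (\<Sum>i\<in>{1..N}. \<bar>slope X v i\<bar> * \<bar>integral {X (i - 1)..X i} ?R\<bar>)"
    using sum_abs[of "\<lambda>i. slope X v i * integral {X (i - 1)..X i} ?R" "{1..N}"] by (simp only: abs_mult)
  also have "\<dots> \<le> (\<Sum>i\<in>{1..N}. \<bar>slope X v i\<bar> * (4 * defect_lip * \<rho> * \<delta> * (X i - X (i - 1))))"
  proof (intro sum_mono mult_left_mono)
    fix i assume i: "i \<in> {1..N}"
    note cell = mesh_cell_subset[OF X i]
    have "integral {X (i - 1)..X i} ?R = Q (X i) - Q (X (i - 1))"
      using cell by (intro lip_deriv_increment[OF Q, symmetric]) auto
    moreover have "i \<le> N" "i - 1 \<le> N" using i by auto
    ultimately have "\<bar>integral {X (i - 1)..X i} ?R\<bar> \<le> B * \<delta> + B * \<delta>"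
      using QX[of i] QX[of "i - 1"] by linarith
    also have "\<dots> = 4 * defect_lip * \<delta> * \<rho> * (1 / (\<rho> * real N))"
      using \<rho> N by (simp add: B_def field_simps)
    also have "\<dots> \<le> 4 * defect_lip * \<delta> * \<rho> * (X i - X (i - 1))"
      using Xmin[OF i] defect_lip_nonneg \<rho> near[of 0] by (intro mult_left_mono) auto
    finally show "\<bar>integral {X (i - 1)..X i} ?R\<bar> \<le> 4 * defect_lip * \<rho> * \<delta> * (X i - X (i - 1))"
      by (simp add: mult_ac)
  qed auto
  also have "\<dots> = 4 * defect_lip * \<rho> * \<delta> * l1_norm (fe_deriv N X v)"
    unfolding l1_norm_def integral_abs_piecewise_const[OF X] by (simp add: sum_distrib_left mult_ac)
  finally show ?thesis .
qed

text \<open>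
  When the second argument is piecewise linear, a first argument that vanishes at the nodes enters
  the bilinear form through its maximum norm only: integrate by parts on each cell in the diffusion
  term, where no boundary terms arise, and on the whole interval in the convection term.
\<close>

lemma form_vanishing_at_nodes:
  assumes X: "mesh N X" "N \<ge> 1" and \<theta>: "lip_deriv \<theta> \<theta>'" "\<And>i. i \<le> N \<Longrightarrow> \<theta> (X i) = 0"
    and \<eta>: "\<And>x. x \<in> {0..1} \<Longrightarrow> \<bar>\<theta> x\<bar> \<le> \<eta>" and v: "v \<in> fe_space N X"
  shows "\<bar>form \<theta> \<theta>' v (fe_deriv N X v)\<bar> \<le> 4 * K * \<eta> * l1_norm (fe_deriv N X v)"
proof -
  let ?g = "fe_deriv N X v"
  have v01: "v 0 = 0" "v 1 = 0" using v by (auto simp: fe_space_def)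
  note lv = fe_space_lip_deriv[OF X v]
  note bm = lip_deriv_bdd_meas_fun[OF lv] lip_deriv_bdd_meas[OF lv] lip_deriv_bdd_meas_fun[OF \<theta>(1)]
    lip_deriv_bdd_meas[OF \<theta>(1)]
  note i = bdd_meas_integrable[of _ 0 1] bdd_meas_intros coeffs_bdd_meas bm
  have \<eta>0: "\<eta> \<ge> 0" using \<eta>[of 0] by auto
  have vle: "\<bar>v x\<bar> \<le> l1_norm ?g" if "x \<in> {0..1}" for x
    unfolding l1_norm_def by (rule lip_deriv_abs_le[OF lv v01(1) that])
  have n0: "l1_norm ?g \<ge> 0" by (rule l1_norm_nonneg[OF bm(2)])
  have cell: "integral {X (j - 1)..X j} (\<lambda>x. A x * \<theta>' x) = integral {X (j - 1)..X j} (\<lambda>x. - (A' x * \<theta> x))"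
    if j: "j \<in> {1..N}" for j
  proof -
    have "\<theta> (X j) = 0" "\<theta> (X (j - 1)) = 0" using j by (auto intro: \<theta>(2))
    then show ?thesis
      using integral_by_parts_lip[OF A \<theta>(1) mesh_cell_subset[OF X(1) j]] by simp
  qed
  have "integral {0..1} (\<lambda>x. (A x * \<theta>' x) * ?g x) = integral {0..1} (\<lambda>x. (- (A' x * \<theta> x)) * ?g x)"
    using cell by (subst (1 2) integral_mult_piecewise_const[OF X(1)]) (auto intro!: i sum.cong)
  also have "\<bar>\<dots>\<bar> \<le> (K * \<eta>) * l1_norm ?g"
    unfolding l1_norm_def
  proof (rule integral_abs_mult_le)
    fix x :: real assume x: "x \<in> {0..1}"
    show "\<bar>- (A' x * \<theta> x)\<bar> \<le> K * \<eta>"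
      unfolding abs_minus_cancel abs_mult using bounds(2)[OF x] \<eta>[OF x] K_nonneg by (intro mult_mono) auto
  qed (auto intro!: i)
  finally have 1: "\<bar>integral {0..1} (\<lambda>x. A x * \<theta>' x * ?g x)\<bar> \<le> K * \<eta> * l1_norm ?g" .
  have "integral {0..1} (\<lambda>x. (b x * v x) * \<theta>' x) = - integral {0..1} (\<lambda>x. (b' x * v x + b x * ?g x) * \<theta> x)"
    using integral_by_parts_lip[OF lip_deriv_mult[OF b lv] \<theta>(1), of 0 1] v01 by simp
  also have "integral {0..1} (\<lambda>x. (b' x * v x + b x * ?g x) * \<theta> x)
      = integral {0..1} (\<lambda>x. (b' x * v x) * \<theta> x + (b x * \<theta> x) * ?g x)"
    by (rule integral_cong) (simp add: algebra_simps)
  also have "\<dots> = integral {0..1} (\<lambda>x. (b' x * v x) * \<theta> x) + integral {0..1} (\<lambda>x. (b x * \<theta> x) * ?g x)"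
    by (intro integral_add; intro i; simp)
  finally have "\<bar>integral {0..1} (\<lambda>x. (b x * v x) * \<theta>' x)\<bar>
      \<le> \<bar>integral {0..1} (\<lambda>x. (b' x * v x) * \<theta> x)\<bar> + \<bar>integral {0..1} (\<lambda>x. (b x * \<theta> x) * ?g x)\<bar>"
    by simp
  also have "\<dots> \<le> (K * l1_norm ?g * \<eta>) * (1 - 0) + (K * \<eta>) * l1_norm ?g"
  proof (rule add_mono)
    show "\<bar>integral {0..1} (\<lambda>x. (b' x * v x) * \<theta> x)\<bar> \<le> (K * l1_norm ?g * \<eta>) * (1 - 0)"
      using bounds(4) vle \<eta> K_nonneg n0 \<eta>0
      by (intro bdd_meas_abs_integral_le[where S = "{}"] i) (auto simp: abs_mult intro!: mult_mono)
    show "\<bar>integral {0..1} (\<lambda>x. (b x * \<theta> x) * ?g x)\<bar> \<le> (K * \<eta>) * l1_norm ?g"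
      unfolding l1_norm_def
    proof (rule integral_abs_mult_le)
      fix x :: real assume x: "x \<in> {0..1}"
      show "\<bar>b x * \<theta> x\<bar> \<le> K * \<eta>"
        unfolding abs_mult using bounds(3)[OF x] \<eta>[OF x] K_nonneg by (intro mult_mono) auto
    qed (auto intro!: i)
  qed
  also have "integral {0..1} (\<lambda>x. (b x * v x) * \<theta>' x) = integral {0..1} (\<lambda>x. b x * \<theta>' x * v x)"
    by (rule integral_cong) (simp add: mult_ac)
  finally have 2: "\<bar>integral {0..1} (\<lambda>x. b x * \<theta>' x * v x)\<bar> \<le> 2 * K * \<eta> * l1_norm ?g" by simp
  have 3: "\<bar>integral {0..1} (\<lambda>x. c x * \<theta> x * v x)\<bar> \<le> (K * \<eta> * l1_norm ?g) * (1 - 0)"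
    using bounds(5) vle \<eta> K_nonneg n0 \<eta>0
    by (intro bdd_meas_abs_integral_le[where S = "{}"] i) (auto simp: abs_mult intro!: mult_mono)
  have "form \<theta> \<theta>' v ?g = integral {0..1} (\<lambda>x. A x * \<theta>' x * ?g x + b x * \<theta>' x * v x)
      + integral {0..1} (\<lambda>x. c x * \<theta> x * v x)"
    unfolding form_def by (intro integral_add; intro i; simp)
  also have "integral {0..1} (\<lambda>x. A x * \<theta>' x * ?g x + b x * \<theta>' x * v x)
      = integral {0..1} (\<lambda>x. A x * \<theta>' x * ?g x) + integral {0..1} (\<lambda>x. b x * \<theta>' x * v x)"
    by (intro integral_add; intro i; simp)
  finally show ?thesis using 1 2 3 by simp
qed

definition perturb_const :: "real \<Rightarrow> real" where
  "perturb_const \<rho> = (4 * defect_lip * \<rho> + 8 * K * grad_bound) / a0 + 2 * grad_bound"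

text \<open>
  The main estimate: in the maximum norm, finite element solutions depend on the mesh in a Lipschitz
  continuous way, uniformly in \<open>N\<close>.
\<close>

lemma galerkin_perturbation:
  assumes uX: "galerkin N X uX" and uY: "galerkin N Y uY"
    and Y: "mesh N Y" and X: "mesh N X" and N: "N \<ge> 1"
    and Ymax: "\<And>i. i \<in> {1..N} \<Longrightarrow> Y i - Y (i - 1) \<le> 2 / real N"
    and Xmin: "\<And>i. i \<in> {1..N} \<Longrightarrow> 1 / (\<rho> * real N) \<le> X i - X (i - 1)" and \<rho>: "\<rho> > 0"
    and near: "\<And>i. i \<le> N \<Longrightarrow> \<bar>X i - Y i\<bar> \<le> \<delta>" and x: "x \<in> {0..1}"
  shows "\<bar>uX x - uY x\<bar> \<le> perturb_const \<rho> * \<delta>"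
proof -
  let ?I = "interpolant N X uY"
  have uY_fe: "uY \<in> fe_space N Y" and uX_fe: "uX \<in> fe_space N X" using uX uY by (auto simp: galerkin_def)
  note lX = galerkin_lip(1)[OF uX X N] and lY = galerkin_lip(1)[OF uY Y N]
  note u01 = galerkin_lip(2,3)[OF uY]
  note lI = interpolant_lip_deriv[of N X uY]
  define M where "M = grad_bound"
  have M0: "M \<ge> 0" using grad_bound_nonneg by (simp add: M_def)
  have \<delta>0: "\<delta> \<ge> 0" using near[of 0] by auto
  have I: "?I \<in> fe_space N X" "fe_deriv N X ?I = fe_deriv N X uY"
    using interpolant_fe_space[of N X uY] X u01 by auto
  define w where "w = (\<lambda>x. uX x - ?I x)"
  define w' where "w' = fe_deriv N X w"
  have w: "w \<in> fe_space N X" unfolding w_def by (rule fe_space_diff[OF uX_fe I(1)])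
  have w01: "w 0 = 0" "w 1 = 0" using w by (auto simp: fe_space_def)
  have lw: "lip_deriv w w'" unfolding w'_def by (rule fe_space_lip_deriv[OF X N w])
  have w'_eq: "w' = (\<lambda>x. fe_deriv N X uX x - fe_deriv N X uY x)"
    unfolding w'_def w_def fe_deriv_diff I(2) ..
  define \<theta> where "\<theta> = (\<lambda>x. uY x - ?I x)"
  define \<theta>' where "\<theta>' = (\<lambda>x. fe_deriv N Y uY x - fe_deriv N X uY x)"
  have l\<theta>: "lip_deriv \<theta> \<theta>'" unfolding \<theta>_def \<theta>'_def by (rule lip_deriv_diff[OF lY lI])
  have \<theta>_node: "\<theta> (X i) = 0" if "i \<le> N" for i
    using interpolant_node[of N X uY i] X u01 that by (simp add: \<theta>_def)
  have \<theta>_le: "\<bar>\<theta> y\<bar> \<le> 2 * M * \<delta>" if "y \<in> {0..1}" for y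
    unfolding \<theta>_def M_def
    by (rule interpolation_error_nearby_mesh[OF X Y N uY_fe near galerkin_grad_bound[OF uY Y N] that])
  note bm = lip_deriv_bdd_meas_fun[OF lX] lip_deriv_bdd_meas[OF lX] lip_deriv_bdd_meas_fun[OF lY]
    lip_deriv_bdd_meas[OF lY] lip_deriv_bdd_meas_fun[OF lI] lip_deriv_bdd_meas[OF lI]
    lip_deriv_bdd_meas_fun[OF lw] lip_deriv_bdd_meas[OF lw]
  have "form w w' w w' = form uX (fe_deriv N X uX) w w' - form ?I (fe_deriv N X uY) w w'"
    unfolding w'_eq by (subst (1) w_def, rule form_diff) (use bm in \<open>auto simp: w'_eq\<close>)
  also have "form uX (fe_deriv N X uX) w w' = integral {0..1} (\<lambda>x. f x * w x)"
    using uX w unfolding galerkin_def w'_def by blast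
  also have "form ?I (fe_deriv N X uY) w w' = form uY (fe_deriv N Y uY) w w' - form \<theta> \<theta>' w w'"
    unfolding \<theta>_def \<theta>'_def by (subst form_diff) (use bm in auto)
  finally have "form w w' w w'
      = (integral {0..1} (\<lambda>x. f x * w x) - form uY (fe_deriv N Y uY) w w') + form \<theta> \<theta>' w w'" by simp
  also have "\<dots> \<le> 4 * defect_lip * \<rho> * \<delta> * l1_norm w' + 4 * K * (2 * M * \<delta>) * l1_norm w'"
    using consistency_error[OF uY Y X N Ymax Xmin \<rho> near w]
      form_vanishing_at_nodes[OF X N l\<theta> \<theta>_node \<theta>_le w] unfolding w'_def by linarith
  also have "\<dots> = ((4 * defect_lip * \<rho> + 8 * K * M) * \<delta>) * l1_norm w'"
    by (simp add: algebra_simps)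
  finally have "l1_norm w' \<le> ((4 * defect_lip * \<rho> + 8 * K * M) * \<delta>) / a0 \<or> l1_norm w' = 0"
    by (rule l1_norm_le_if_form_le[OF lw w01])
  moreover have "0 \<le> ((4 * defect_lip * \<rho> + 8 * K * M) * \<delta>) / a0"
    using defect_lip_nonneg \<rho> K_nonneg M0 \<delta>0 a0 by auto
  ultimately have "l1_norm w' \<le> ((4 * defect_lip * \<rho> + 8 * K * M) * \<delta>) / a0" by auto
  moreover have "\<bar>w x\<bar> \<le> l1_norm w'"
    unfolding l1_norm_def by (rule lip_deriv_abs_le[OF lw w01(1) x])
  moreover have "uX x - uY x = w x - \<theta> x" by (simp add: w_def \<theta>_def)
  ultimately have "\<bar>uX x - uY x\<bar> \<le> ((4 * defect_lip * \<rho> + 8 * K * M) * \<delta>) / a0 + 2 * M * \<delta>"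
    using \<theta>_le[OF x] by linarith
  also have "\<dots> = perturb_const \<rho> * \<delta>"
    by (simp add: perturb_const_def M_def algebra_simps)
  finally show ?thesis .
qed

end

section \<open>The boundary value problem in terms of Lipschitz representatives\<close>

lemma continuous_ge_if_AE_ge:
  assumes A: "continuous_on {0..1} A" and ge: "AE x in leb_Om. A x \<ge> k" and x: "x \<in> {0..1}"
  shows "A x \<ge> (k::real)"
proof (rule ccontr)
  assume "\<not> A x \<ge> k"
  then have "k - A x > 0" by simp
  then obtain d where d: "d > 0" "\<And>y. y \<in> {0..1} \<Longrightarrow> dist y x < d \<Longrightarrow> dist (A y) (A x) < k - A x"
    using A x unfolding continuous_on_iff by metis
  obtain S where S: "negligible S" "\<And>y. y \<in> Om \<Longrightarrow> y \<notin> S \<Longrightarrow> A y \<ge> k"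
    using ge unfolding AE_leb_Om_iff_negligible by blast
  have "ball x d \<inter> Om \<subseteq> S"
  proof
    fix y assume y: "y \<in> ball x d \<inter> Om"
    then have "dist (A y) (A x) < k - A x" by (intro d(2)) (auto simp: dist_commute)
    then have "A y < k" by (auto simp: dist_real_def)
    then show "y \<in> S" using S(2)[of y] y by force
  qed
  then have "negligible (ball x d \<inter> Om)" using S(1) negligible_subset by blast
  moreover have "open (ball x d \<inter> Om)" by auto
  ultimately have "ball x d \<inter> Om = {}" using open_not_negligible by blast
  moreover have "x \<in> closure Om" using x by (simp add: closure_greaterThanLessThan)
  then have "ball x d \<inter> Om \<noteq> {}"
    using d(1) unfolding closure_approachable by (metis IntI dist_commute empty_iff mem_ball)
  ultimately show False by simp
qed

lemma abs_node_diff_le_mesh_dist: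
  assumes "mesh N X" "mesh N Y" "i \<le> N"
  shows "\<bar>X i - Y i\<bar> \<le> mesh_dist N X Y"
proof -
  have "\<bar>X i - Y i\<bar> \<in> insert 0 ((\<lambda>i. \<bar>X i - Y i\<bar>) ` {1..N - 1})"
  proof (cases "i = 0 \<or> i = N")
    case True
    then show ?thesis using assms by (auto simp: mesh_def)
  next
    case False
    then have "i \<in> {1..N - 1}" using assms(3) by auto
    then show ?thesis by blast
  qed
  then show ?thesis unfolding mesh_dist_def by (intro Max_ge) auto
qed

lemma rho0_ge_1: "rho0 C1 C2 r \<ge> 1"
  unfolding rho0_def gamma_const_def by (intro one_le_power) auto

lemma wderiv_fe:
  assumes "mesh N X" "N \<ge> 1" "v \<in> fe_space N X"
  shows "AE x in leb_Om. wderiv v x = fe_deriv N X v x"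
  by (rule wderiv_AE_eq[OF lip_deriv_has_weak_deriv[OF fe_space_lip_deriv[OF assms]]])

text \<open>
  The coefficients \<open>a, b, c, f\<close> of the problem agree almost everywhere with well-behaved
  representatives \<open>A, b1, c1, f1\<close>.
\<close>

locale boundary_value_problem = convection_diffusion A A' b1 b1' c1 f1 a0 K
  for A A' b1 b1' c1 f1 :: "real \<Rightarrow> real" and a0 K :: real +
  fixes a b c f :: "real \<Rightarrow> real"
  assumes a_eq: "AE x in leb_Om. a x = A x" and b_eq: "AE x in leb_Om. b x = b1 x"
    and b'_eq: "AE x in leb_Om. wderiv b x = b1' x"
    and c_eq: "AE x in leb_Om. c x = c1 x" and f_eq: "AE x in leb_Om. f x = f1 x"
begin

lemma L2_inner_fe:
  assumes "mesh N X" "N \<ge> 1" "v \<in> fe_space N X"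
  shows "L2_inner f v = integral {0..1} (\<lambda>x. f1 x * v x)"
  unfolding L2_inner_def
proof (rule LINT_Om_eq_integral(2))
  show "bdd_meas (\<lambda>x. f1 x * v x)"
    by (intro bdd_meas_intros coeffs_bdd_meas lip_deriv_bdd_meas_fun[OF fe_space_lip_deriv[OF assms]])
  show "AE x in leb_Om. f x * v x = f1 x * v x"
    using f_eq by eventually_elim simp
qed

lemma bilin_fe:
  assumes X: "mesh N X" "N \<ge> 1" and u: "u \<in> fe_space N X" and v: "v \<in> fe_space N X"
  shows "bilin a b c u v = form u (fe_deriv N X u) v (fe_deriv N X v)"
  unfolding bilin_def form_def
proof (rule LINT_Om_eq_integral(2))
  note lu = fe_space_lip_deriv[OF X u] and lv = fe_space_lip_deriv[OF X v]
  show "bdd_meas (\<lambda>x. A x * fe_deriv N X u x * fe_deriv N X v x + b1 x * fe_deriv N X u x * v x + c1 x * u x * v x)"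
    by (intro bdd_meas_intros coeffs_bdd_meas bdd_meas_piecewise_const
        lip_deriv_bdd_meas_fun[OF lu] lip_deriv_bdd_meas_fun[OF lv])
  show "AE x in leb_Om. a x * wderiv u x * wderiv v x + b x * wderiv u x * v x + c x * u x * v x
      = A x * fe_deriv N X u x * fe_deriv N X v x + b1 x * fe_deriv N X u x * v x + c1 x * u x * v x"
    using a_eq b_eq c_eq wderiv_fe[OF X u] wderiv_fe[OF X v] by eventually_elim simp
qed

lemma fe_solution_galerkin:
  assumes "mesh N X" "N \<ge> 1" "fe_solution a b c f N X u"
  shows "galerkin N X u"
  using assms bilin_fe[OF assms(1,2)] L2_inner_fe[OF assms(1,2)]
  by (auto simp: galerkin_def fe_solution_def)

text \<open>Testing the finite element equations with the solution makes the energy linear in \<open>u\<close>.\<close>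

lemma energy_norm_fe_solution:
  assumes X: "mesh N X" "N \<ge> 1" and u: "galerkin N X u"
  shows "(energy_norm a b c u)\<^sup>2 = integral {0..1} (\<lambda>x. f1 x * u x)"
proof -
  have fe: "u \<in> fe_space N X" using u by (simp add: galerkin_def)
  note lu = galerkin_lip(1)[OF u X] and u01 = galerkin_lip(2,3)[OF u]
  let ?g = "fe_deriv N X u"
  let ?E = "\<lambda>x. A x * (?g x)\<^sup>2 + (c1 x - b1' x / 2) * (u x)\<^sup>2"
  have "(LINT x|leb_Om. a x * (wderiv u x)\<^sup>2 + (c x - wderiv b x / 2) * (u x)\<^sup>2) = integral {0..1} ?E"
  proof (rule LINT_Om_eq_integral(2))
    show "bdd_meas ?E"
      by (intro bdd_meas_intros coeffs_bdd_meas bdd_meas_piecewise_const lip_deriv_bdd_meas_fun[OF lu])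
    show "AE x in leb_Om. a x * (wderiv u x)\<^sup>2 + (c x - wderiv b x / 2) * (u x)\<^sup>2 = ?E x"
      using a_eq b'_eq c_eq wderiv_fe[OF X fe] by eventually_elim simp
  qed
  moreover have "integral {0..1} ?E \<ge> 0"
    by (intro energy_nonneg bdd_meas_piecewise_const lip_deriv_bdd_meas_fun[OF lu])
  ultimately have "(energy_norm a b c u)\<^sup>2 = integral {0..1} ?E"
    by (simp add: energy_norm_def)
  also have "\<dots> = form u ?g u ?g" using form_energy[OF lu u01] by simp
  also have "\<dots> = integral {0..1} (\<lambda>x. f1 x * u x)" using u fe by (simp add: galerkin_def)
  finally show ?thesis .
qed

text \<open>
  The difference of the two solutions is bounded by \<open>P \<delta>\<close>. The first estimate follows because it
  has at most \<open>2 N + 3\<close> linear pieces (a count without regard to repeated nodes), and the other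
  two because \<open>\<delta> < 1 / N\<close> gives \<open>\<delta> \<le> (\<delta> / N) powr (1 / 2)\<close>.
\<close>

lemma stability_estimates:
  assumes N: "N \<ge> 1" and \<rho>: "\<rho> \<ge> 1" and X: "X \<in> mesh_class \<rho> N" and Y: "Y \<in> mesh_class \<rho> N"
    and dist: "mesh_dist N X Y < 1 / (\<rho> * real N)"
    and uX: "fe_solution a b c f N X uX" and uY: "fe_solution a b c f N Y uY"
  defines "P \<equiv> \<bar>perturb_const \<rho>\<bar>" and "\<delta> \<equiv> mesh_dist N X Y"
  shows "Lp_norm 1 (wderiv (\<lambda>x. uX x - uY x)) \<le> 10 * P * real N * \<delta>"
    and "Lp_norm 2 (\<lambda>x. uX x - uY x) \<le> P * real N powr (- 1 / 2) * \<delta> powr (1 / 2)"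
    and "\<bar>(energy_norm a b c uX)\<^sup>2 - (energy_norm a b c uY)\<^sup>2\<bar>
      \<le> K * P * real N powr (- 1 / 2) * \<delta> powr (1 / 2)"
proof -
  have mX: "mesh N X" and mY: "mesh N Y" using X Y by (auto simp: mesh_class_def)
  have near: "\<bar>X i - Y i\<bar> \<le> \<delta>" if "i \<le> N" for i
    unfolding \<delta>_def using abs_node_diff_le_mesh_dist[OF mX mY that] .
  have \<delta>0: "\<delta> \<ge> 0" using near[of 0] by auto
  have gX: "galerkin N X uX" and gY: "galerkin N Y uY"
    using fe_solution_galerkin[OF mX N uX] fe_solution_galerkin[OF mY N uY] by auto
  define e where "e = (\<lambda>x. uX x - uY x)"
  define g where "g = (\<lambda>x. fe_deriv N X uX x - fe_deriv N Y uY x)"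
  have le: "lip_deriv e g"
    unfolding e_def g_def by (rule lip_deriv_diff[OF galerkin_lip(1)[OF gX mX N] galerkin_lip(1)[OF gY mY N]])
  have be: "bdd_meas e" "bdd_meas g" using lip_deriv_bdd_meas_fun[OF le] lip_deriv_bdd_meas[OF le] by auto
  have P0: "P \<ge> 0" by (simp add: P_def)
  have e_le: "\<bar>e x\<bar> \<le> P * \<delta>" if x: "x \<in> {0..1}" for x
  proof -
    have "\<bar>e x\<bar> \<le> perturb_const \<rho> * \<delta>"
      unfolding e_def
      by (rule galerkin_perturbation[OF gX gY mY mX N _ _ _ near x])
         (use X Y \<rho> in \<open>auto simp: mesh_class_def\<close>)
    also have "\<dots> \<le> P * \<delta>" unfolding P_def using \<delta>0 by (intro mult_right_mono) auto
    finally show ?thesis .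
  qed
  have "\<delta> \<le> 1 / real N"
  proof -
    have "1 / (\<rho> * real N) \<le> 1 / (1 * real N)"
      using N \<rho> by (intro divide_left_mono mult_right_mono) auto
    then show ?thesis using dist by (simp add: \<delta>_def)
  qed
  then have "\<delta> powr (1 / 2) \<le> (1 / real N) powr (1 / 2)"
    using \<delta>0 by (intro powr_mono2) auto
  also have "\<dots> = real N powr (- 1 / 2)"
    using N by (simp add: powr_minus_divide powr_divide)
  finally have "\<delta> powr (1 / 2) * \<delta> powr (1 / 2) \<le> real N powr (- 1 / 2) * \<delta> powr (1 / 2)"
    by (intro mult_right_mono) auto
  moreover have "\<delta> powr (1 / 2) * \<delta> powr (1 / 2) = \<delta>"
    using \<delta>0 by (simp add: powr_half_sqrt)
  ultimately have \<delta>_le: "\<delta> \<le> real N powr (- 1 / 2) * \<delta> powr (1 / 2)" by simp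

  let ?S = "X ` {..N} \<union> Y ` {..N}"
  have "Lp_norm 1 (wderiv e) = (LINT x|leb_Om. \<bar>wderiv e x\<bar> powr 1) powr 1"
    by (simp add: Lp_norm_def)
  also have "(LINT x|leb_Om. \<bar>wderiv e x\<bar> powr 1) = integral {0..1} (\<lambda>x. \<bar>g x\<bar>)"
  proof (rule LINT_Om_eq_integral(2)[OF bdd_meas_abs[OF be(2)]])
    show "AE x in leb_Om. \<bar>wderiv e x\<bar> powr 1 = \<bar>g x\<bar>"
      using wderiv_AE_eq[OF lip_deriv_has_weak_deriv[OF le]] by eventually_elim simp
  qed
  also have "\<dots> powr 1 = \<dots>"
    using l1_norm_nonneg[OF be(2)] by (simp add: l1_norm_def)
  also have "\<dots> \<le> 2 * (P * \<delta>) * (real (card ({0<..<1} \<inter> ?S)) + 1)"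
  proof (rule total_variation_piecewise_linear[OF le e_le])
    fix l r x y :: real
    assume S: "{l<..<r} \<inter> ?S = {}" and xy: "x \<in> {l<..<r}" "y \<in> {l<..<r}"
    have "fe_deriv N X uX x = fe_deriv N X uX y"
      by (rule piecewise_const_no_node[OF _ xy]) (use S in blast)
    moreover have "fe_deriv N Y uY x = fe_deriv N Y uY y"
      by (rule piecewise_const_no_node[OF _ xy]) (use S in blast)
    ultimately show "g x = g y" by (simp add: g_def)
  qed auto
  also have "\<dots> \<le> 2 * (P * \<delta>) * (5 * real N)"
  proof (rule mult_left_mono)
    have "card ({0<..<1} \<inter> ?S) \<le> card ?S" by (intro card_mono) auto
    also have "\<dots> \<le> card (X ` {..N}) + card (Y ` {..N})" by (rule card_Un_le)
    also have "\<dots> \<le> card {..N} + card {..N}" by (intro add_mono card_image_le) auto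
    finally show "real (card ({0<..<1} \<inter> ?S)) + 1 \<le> 5 * real N" using N by simp
  qed (use P0 \<delta>0 in auto)
  finally show "Lp_norm 1 (wderiv (\<lambda>x. uX x - uY x)) \<le> 10 * P * real N * \<delta>"
    by (simp add: e_def mult_ac)

  have "Lp_norm 2 e = (LINT x|leb_Om. \<bar>e x\<bar> powr 2) powr (1 / 2)"
    by (simp add: Lp_norm_def)
  also have "(LINT x|leb_Om. \<bar>e x\<bar> powr 2) = integral {0..1} (\<lambda>x. (e x)\<^sup>2)"
    by (rule LINT_Om_eq_integral(2)[OF bdd_meas_power[OF be(1)]]) (simp add: powr_numeral)
  also have "\<dots> powr (1 / 2) \<le> ((P * \<delta>)\<^sup>2) powr (1 / 2)"
  proof (rule powr_mono2)
    show "0 \<le> integral {0..1} (\<lambda>x. (e x)\<^sup>2)"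
      by (intro integral_nonneg bdd_meas_integrable bdd_meas_power be) auto
    have "\<bar>integral {0..1} (\<lambda>x. (e x)\<^sup>2)\<bar> \<le> (P * \<delta>)\<^sup>2 * (1 - 0)"
    proof (rule bdd_meas_abs_integral_le[where S = "{}"])
      fix x :: real assume "0 \<le> x" "x \<le> 1"
      then show "\<bar>(e x)\<^sup>2\<bar> \<le> (P * \<delta>)\<^sup>2"
        using power_mono[OF e_le[of x], of 2] by simp
    qed (auto intro: bdd_meas_power be)
    then show "integral {0..1} (\<lambda>x. (e x)\<^sup>2) \<le> (P * \<delta>)\<^sup>2" by simp
  qed simp
  also have "((P * \<delta>)\<^sup>2) powr (1 / 2) = P * \<delta>"
    using P0 \<delta>0 by (simp add: powr_half_sqrt)
  also have "\<dots> \<le> P * (real N powr (- 1 / 2) * \<delta> powr (1 / 2))"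
    using \<delta>_le P0 by (rule mult_left_mono)
  finally show "Lp_norm 2 (\<lambda>x. uX x - uY x) \<le> P * real N powr (- 1 / 2) * \<delta> powr (1 / 2)"
    by (simp add: e_def mult_ac)

  have bu: "bdd_meas uX" "bdd_meas uY"
    using lip_deriv_bdd_meas_fun galerkin_lip(1)[OF gX mX N] galerkin_lip(1)[OF gY mY N] by blast+
  have "(energy_norm a b c uX)\<^sup>2 - (energy_norm a b c uY)\<^sup>2
      = integral {0..1} (\<lambda>x. f1 x * uX x) - integral {0..1} (\<lambda>x. f1 x * uY x)"
    using energy_norm_fe_solution[OF mX N gX] energy_norm_fe_solution[OF mY N gY] by simp
  also have "\<dots> = integral {0..1} (\<lambda>x. f1 x * e x)"
    by (subst integral_diff[symmetric])
       (auto intro!: bdd_meas_integrable bdd_meas_intros coeffs_bdd_meas bu simp: e_def algebra_simps)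
  also have "\<bar>\<dots>\<bar> \<le> (K * (P * \<delta>)) * (1 - 0)"
  proof (rule bdd_meas_abs_integral_le[where S = "{}"])
    fix x :: real assume "0 \<le> x" "x \<le> 1"
    then show "\<bar>f1 x * e x\<bar> \<le> K * (P * \<delta>)"
      unfolding abs_mult using bounds(6)[of x] e_le[of x] K_nonneg by (intro mult_mono) auto
  qed (use K_nonneg P0 \<delta>0 in \<open>auto intro!: bdd_meas_intros coeffs_bdd_meas be\<close>)
  also have "(K * (P * \<delta>)) * (1 - 0) \<le> (K * P) * (real N powr (- 1 / 2) * \<delta> powr (1 / 2))"
    using mult_left_mono[OF \<delta>_le, of "K * P"] K_nonneg P0 by (simp add: mult.assoc)
  finally show "\<bar>(energy_norm a b c uX)\<^sup>2 - (energy_norm a b c uY)\<^sup>2\<bar>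
      \<le> K * P * real N powr (- 1 / 2) * \<delta> powr (1 / 2)"
    by (simp add: mult.assoc)
qed

end

lemma representatives_exist:
  assumes a: "a \<in> W1inf_space" and b: "b \<in> W1inf_space" and c: "c \<in> Linf_space" and f: "f \<in> Linf_space"
    and a0: "a0 > 0" and coercive: "AE x in leb_Om. a x \<ge> a0"
    and nonneg: "AE x in leb_Om. c x - wderiv b x / 2 \<ge> 0"
  obtains A A' b1 b1' c1 f1 K where "boundary_value_problem A A' b1 b1' c1 f1 a0 K a b c f"
proof -
  obtain A A' where A: "lip_deriv A A'" "AE x in leb_Om. a x = A x"
    using W1inf_space_lipschitz_representative[OF a] by blast
  obtain b1 b1' where b1: "lip_deriv b1 b1'" "AE x in leb_Om. b x = b1 x" "AE x in leb_Om. wderiv b x = b1' x"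
    using W1inf_space_lipschitz_representative[OF b] by blast
  obtain c0 where c0: "bdd_meas c0" "AE x in leb_Om. c x = c0 x"
    using Linf_space_bounded_representative[OF c] by blast
  obtain f1 where f1: "bdd_meas f1" "AE x in leb_Om. f x = f1 x"
    using Linf_space_bounded_representative[OF f] by blast
  \<comment> \<open>This representative of \<open>c\<close> satisfies the sign condition everywhere.\<close>
  define c1 where "c1 x = max (c0 x) (b1' x / 2)" for x
  have bb: "bdd_meas A" "bdd_meas A'" "bdd_meas b1" "bdd_meas b1'"
    using lip_deriv_bdd_meas_fun lip_deriv_bdd_meas A(1) b1(1) by blast+
  have c1: "bdd_meas c1" unfolding c1_def by (intro bdd_meas_intros c0 bb)
  have c1_eq: "AE x in leb_Om. c x = c1 x"
    using c0(2) b1(3) nonneg by eventually_elim (simp add: c1_def)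
  have "AE x in leb_Om. A x \<ge> a0" using A(2) coercive by eventually_elim simp
  then have A_ge: "A x \<ge> a0" if "x \<in> {0..1}" for x
    using continuous_ge_if_AE_ge[OF lip_deriv_continuous[OF A(1)] _ that] by blast
  let ?s = "\<lambda>x. \<bar>A x\<bar> + \<bar>A' x\<bar> + \<bar>b1 x\<bar> + \<bar>b1' x\<bar> + \<bar>c1 x\<bar> + \<bar>f1 x\<bar>"
  have "bdd_meas ?s" by (intro bdd_meas_intros bb c1 f1)
  then obtain K where K: "\<And>x. x \<in> {0..1} \<Longrightarrow> \<bar>?s x\<bar> \<le> K" using bdd_measE by blast
  have "boundary_value_problem A A' b1 b1' c1 f1 a0 K a b c f"
  proof
    fix x :: real assume x: "x \<in> {0..1}"
    show "\<bar>A x\<bar> \<le> K" "\<bar>A' x\<bar> \<le> K" "\<bar>b1 x\<bar> \<le> K" "\<bar>b1' x\<bar> \<le> K" "\<bar>c1 x\<bar> \<le> K" "\<bar>f1 x\<bar> \<le> K"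
      using K[OF x] by (smt (verit))+
    show "0 \<le> c1 x - b1' x / 2" by (simp add: c1_def)
    show "a0 \<le> A x" by (rule A_ge[OF x])
  qed (rule A b1 c1 f1 a0 c1_eq)+
  then show ?thesis by (rule that)
qed

section \<open>The stability theorem\<close>

theorem theorem2p3:
  fixes a b c f u :: "real \<Rightarrow> real" and a0 C1 C2 :: real
  assumes a: "a \<in> W1inf_space" and b: "b \<in> W1inf_space" and c: "c \<in> Linf_space"
    and f: "f \<in> Lp_space 2"
    and a0: "a0 > 0" and coercive: "AE x in leb_Om. a x \<ge> a0"
    and nonneg: "AE x in leb_Om. c x - wderiv b x / 2 \<ge> 0"
    and f_nonzero: "\<not> (AE x in leb_Om. f x = 0)"
    and constants: "error_constants a b c C1 C2"
    and u: "weak_solution a b c f u"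
    and f_Linf: "f \<in> Linf_space" and u_H2: "u \<in> H2_space"
  shows "\<exists>C>0. \<forall>N\<ge>1. \<forall>X Y uX uY.
     X \<in> mesh_class (rho0 C1 C2 (resid a b c f u)) N \<and>
     Y \<in> mesh_class (rho0 C1 C2 (resid a b c f u)) N \<and>
     mesh_dist N X Y < 1 / (rho0 C1 C2 (resid a b c f u) * real N) \<and>
     fe_solution a b c f N X uX \<and> fe_solution a b c f N Y uY \<longrightarrow>
       Lp_norm 1 (wderiv (\<lambda>x. uX x - uY x)) \<le> C * real N * mesh_dist N X Y \<and>
       Lp_norm 2 (\<lambda>x. uX x - uY x) \<le> C * real N powr (- 1 / 2) * mesh_dist N X Y powr (1 / 2) \<and>
       \<bar>(energy_norm a b c uX)\<^sup>2 - (energy_norm a b c uY)\<^sup>2\<bar>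
         \<le> C * real N powr (- 1 / 2) * mesh_dist N X Y powr (1 / 2)"
proof -
  obtain A A' b1 b1' c1 f1 K where "boundary_value_problem A A' b1 b1' c1 f1 a0 K a b c f"
    using representatives_exist[OF a b c f_Linf a0 coercive nonneg] .
  then interpret boundary_value_problem A A' b1 b1' c1 f1 a0 K a b c f .
  define \<rho> where "\<rho> = rho0 C1 C2 (resid a b c f u)"
  have \<rho>: "\<rho> \<ge> 1" unfolding \<rho>_def by (rule rho0_ge_1)
  define P where "P = \<bar>perturb_const \<rho>\<bar>"
  define C where "C = 10 * P + K * P + 1"
  have P0: "P \<ge> 0" by (simp add: P_def)
  then have C: "C > 0" "10 * P \<le> C" "P \<le> C" "K * P \<le> C"
    using K_nonneg by (auto simp: C_def add_nonneg_pos)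
  show ?thesis
    unfolding \<rho>_def[symmetric]
  proof (intro exI[of _ C] conjI allI impI; (elim conjE)?)
    show "C > 0" by (rule C)
    fix N X Y uX uY
    assume hyps: "1 \<le> N" "X \<in> mesh_class \<rho> N" "Y \<in> mesh_class \<rho> N"
      "mesh_dist N X Y < 1 / (\<rho> * real N)"
      "fe_solution a b c f N X uX" "fe_solution a b c f N Y uY"
    have \<delta>0: "mesh_dist N X Y \<ge> 0"
      unfolding mesh_dist_def by (intro Max_ge) auto
    note est = stability_estimates[OF hyps(1) \<rho> hyps(2-6), folded P_def]
    show "Lp_norm 1 (wderiv (\<lambda>x. uX x - uY x)) \<le> C * real N * mesh_dist N X Y"
      using est(1) by (rule order_trans) (intro mult_right_mono C \<delta>0; simp)
    show "Lp_norm 2 (\<lambda>x. uX x - uY x) \<le> C * real N powr (- 1 / 2) * mesh_dist N X Y powr (1 / 2)"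
      using est(2) by (rule order_trans) (intro mult_right_mono C; simp)
    show "\<bar>(energy_norm a b c uX)\<^sup>2 - (energy_norm a b c uY)\<^sup>2\<bar>
         \<le> C * real N powr (- 1 / 2) * mesh_dist N X Y powr (1 / 2)"
      using est(3) by (rule order_trans) (intro mult_right_mono C; simp)
  qed
qed

end
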